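(* Let $T$ be a tournament on 8 vertices whose score sequence is one of $(1,2,3,3,4,5,5,5)$, $(1,3,3,3,4,4,4,6)$, $(1,3,4,4,4,4,4,4)$, $(1,2,3,3,4,4,5,6)$, $(1,2,2,4,4,5,5,5)$, $(1,2,4,4,4,4,4,5)$, $(1,3,3,3,3,5,5,5)$, or is the dual of one of these score sequences. Then $T$ is not intrinsically linked as a directed graph.
   Context: A tournament is a directed graph with exactly one directed edge between each pair of distinct vertices. Its score sequence is the list of outdegrees of its vertices in non-decreasing order. The dual of a score sequence $S$ is the score sequence of the tournament obtained by reversing all edges of a tournament with score sequence $S$; the dual of $(s_1,\dots,s_n)$ is $(n-1-s_n,\dots,n-1-s_1)$. A cycle in a directed graph is consistently oriented if it is a directed cycle. A directed graph $G$ is intrinsically linked as a directed graph if every (tame) embedding of $G$ into $S^3$ contains two vertex-disjoint consistently oriented cycles that form a non-split link. *)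

theory Defs
  imports
    "HOL-Analysis.Analysis"
    "HOL-Library.Multiset"
    "Graph_Theory.Digraph"
    "Graph_Theory.Arc_Walk"
begin

section \<open>Tournaments and score sequences\<close>

locale tournament = digraph +
  assumes exactly_one_arc:
    "\<lbrakk>u \<in> verts G; v \<in> verts G; u \<noteq> v\<rbrakk> \<Longrightarrow>
      ((u, v) \<in> arcs_ends G) \<noteq> ((v, u) \<in> arcs_ends G)"

definition score_sequence :: "('a, 'b) pre_digraph \<Rightarrow> nat list" where
  "score_sequence G = sorted_list_of_multiset (image_mset (out_degree G) (mset_set (verts G)))"

definition dual_sequence :: "nat list \<Rightarrow> nat list" where
  "dual_sequence S = rev (map (\<lambda>s. length S - 1 - s) S)"

text \<open>
  The explicit formula agrees with the description of the dual by edge reversal: see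
  \<open>score_sequence_reversal\<close> below. (Scores are at most \<open>n - 1\<close>, so no subtraction is truncated.)
\<close>

definition reversal :: "('a, 'b) pre_digraph \<Rightarrow> ('a, 'b) pre_digraph" where
  "reversal G = G\<lparr>tail := head G, head := tail G\<rparr>"

lemma (in tournament) out_degree_reversal:
  assumes v: "v \<in> verts G"
  shows "out_degree (reversal G) v = card (verts G) - 1 - out_degree G v"
proof -
  let ?O = "out_arcs G v" and ?I = "out_arcs (reversal G) v"
  have I: "?I = {e \<in> arcs G. head G e = v}"
    by (auto simp: reversal_def out_arcs_def)
  have injO: "inj_on (head G) ?O"
    by (rule inj_onI) (auto simp: out_arcs_def arc_to_ends_def intro: no_multi_arcs)
  have injI: "inj_on (tail G) ?I"
    by (rule inj_onI) (auto simp: I arc_to_ends_def intro: no_multi_arcs)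
  have disj: "head G ` ?O \<inter> tail G ` ?I = {}"
  proof (rule ccontr)
    assume "head G ` ?O \<inter> tail G ` ?I \<noteq> {}"
    then obtain x where "x \<in> head G ` ?O" "x \<in> tail G ` ?I" by blast
    then obtain e f where e: "e \<in> arcs G" "tail G e = v"
      and f: "f \<in> arcs G" "head G f = v" and ef: "head G e = tail G f"
      unfolding I by (auto simp del: imageI)
    have "(v, head G e) \<in> arcs_ends G"
      using e by (auto simp: arcs_ends_conv image_iff)
    moreover have "(head G e, v) \<in> arcs_ends G"
      using f ef by (auto simp: arcs_ends_conv image_iff)
    moreover have "head G e \<noteq> v" using no_loops[OF e(1)] e by auto
    ultimately show False
      using exactly_one_arc[of v "head G e"] v e by auto
  qed
  have un: "head G ` ?O \<union> tail G ` ?I = verts G - {v}"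
  proof
    show "head G ` ?O \<union> tail G ` ?I \<subseteq> verts G - {v}"
      using no_loops by (auto simp: I)
    show "verts G - {v} \<subseteq> head G ` ?O \<union> tail G ` ?I"
    proof
      fix w assume w: "w \<in> verts G - {v}"
      then have "(v, w) \<in> arcs_ends G \<or> (w, v) \<in> arcs_ends G"
        using exactly_one_arc[of v w] v by auto
      then show "w \<in> head G ` ?O \<union> tail G ` ?I"
        by (auto simp: I arcs_ends_conv)
    qed
  qed
  have fin: "finite ?O" "finite ?I" by (auto simp: I)
  have "card ?O + card ?I = card (head G ` ?O) + card (tail G ` ?I)"
    by (simp add: card_image injO injI)
  also have "\<dots> = card (head G ` ?O \<union> tail G ` ?I)"
    using fin disj by (simp add: card_Un_disjoint)
  also have "\<dots> = card (verts G) - 1" by (simp add: un v)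
  finally show ?thesis by (simp add: out_degree_def)
qed

lemma (in tournament) score_sequence_reversal:
  "score_sequence (reversal G) = dual_sequence (score_sequence G)"
proof -
  let ?n = "card (verts G)"
  have len: "length (score_sequence G) = ?n"
    unfolding score_sequence_def by (metis mset_sorted_list_of_multiset size_mset size_image_mset size_mset_set)
  have "image_mset (out_degree (reversal G)) (mset_set (verts G))
      = image_mset (\<lambda>v. ?n - 1 - out_degree G v) (mset_set (verts G))"
    by (rule image_mset_cong) (simp add: out_degree_reversal)
  also have "\<dots> = mset (dual_sequence (score_sequence G))"
    by (simp add: dual_sequence_def len) (simp add: score_sequence_def multiset.map_comp o_def)
  finally have "score_sequence (reversal G) = sort (dual_sequence (score_sequence G))"
    by (simp add: score_sequence_def[of "reversal G"]) (simp add: reversal_def)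
  moreover have "sorted (dual_sequence (score_sequence G))"
  proof -
    have "sorted_wrt (\<le>) (score_sequence G)" by (simp add: score_sequence_def)
    then show ?thesis
      unfolding dual_sequence_def sorted_wrt_rev sorted_wrt_map
      by (rule sorted_wrt_mono_rel[rotated]) auto
  qed
  ultimately show ?thesis by (simp add: sorted_sort_id)
qed


section \<open>Tame subsets and split links in the 3-sphere\<close>

abbreviation S3 :: "(real ^ 4) set" where
  "S3 \<equiv> sphere 0 1"

text \<open>
  A proper compact subset of the 3-sphere is tame if some self-homeomorphism of the 3-sphere takes it
  to a (compact) polyhedron, i.e. a finite union of convex polytopes. The PL structure is that
  of real 3-space with a point at infinity: a homeomorphism \<open>h\<close> of \<open>S3 - {q}\<close> with 3-space is the
  same as a homeomorphism of the 3-sphere with the one-point compactification that sends \<open>q\<close> to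
  infinity. (The library's \<open>polyhedron\<close> is a finite intersection of half-spaces, hence convex.)
\<close>

definition tame :: "(real ^ 4) set \<Rightarrow> bool" where
  "tame X \<longleftrightarrow> X \<subseteq> S3 \<and>
     (\<exists>q h k P. q \<in> S3 - X \<and> homeomorphism (S3 - {q}) (UNIV :: (real ^ 3) set) h k \<and>
        finite P \<and> (\<forall>C\<in>P. polytope C) \<and> h ` X = \<Union>P)"

definition split_link :: "(real ^ 4) set \<Rightarrow> (real ^ 4) set \<Rightarrow> bool" where
  "split_link K L \<longleftrightarrow>
     (\<exists>\<Sigma>. \<Sigma> homeomorphic sphere (0 :: real ^ 3) 1 \<and> tame \<Sigma> \<and>
        (\<exists>C \<in> components (S3 - \<Sigma>). \<exists>D \<in> components (S3 - \<Sigma>). C \<noteq> D \<and> K \<subseteq> C \<and> L \<subseteq> D))"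


section \<open>Embeddings of directed graphs\<close>

text \<open>
  A topological embedding of a finite directed graph, viewed as a 1-complex, into the 3-sphere is given by
  an injective placement \<open>p\<close> of the vertices together with, for every arc, a simple path \<open>g e\<close>
  from the tail to the head, such that these paths meet vertices and each other only at common
  ends. For a non-loop the injectivity of \<open>p\<close> makes \<open>g e\<close> an injective path.
\<close>

definition graph_image ::
    "('a, 'b) pre_digraph \<Rightarrow> ('a \<Rightarrow> real ^ 4) \<Rightarrow> ('b \<Rightarrow> real \<Rightarrow> real ^ 4) \<Rightarrow> (real ^ 4) set" where
  "graph_image G p g = p ` verts G \<union> (\<Union>e\<in>arcs G. path_image (g e))"

definition graph_embedding ::
    "('a, 'b) pre_digraph \<Rightarrow> ('a \<Rightarrow> real ^ 4) \<Rightarrow> ('b \<Rightarrow> real \<Rightarrow> real ^ 4) \<Rightarrow> bool" where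
  "graph_embedding G p g \<longleftrightarrow>
     inj_on p (verts G) \<and>
     graph_image G p g \<subseteq> S3 \<and>
     (\<forall>e\<in>arcs G. simple_path (g e) \<and>
        pathstart (g e) = p (tail G e) \<and> pathfinish (g e) = p (head G e)) \<and>
     (\<forall>e\<in>arcs G. \<forall>v\<in>verts G. p v \<in> path_image (g e) \<longrightarrow> v \<in> {tail G e, head G e}) \<and>
     (\<forall>e\<in>arcs G. \<forall>f\<in>arcs G. e \<noteq> f \<longrightarrow>
        path_image (g e) \<inter> path_image (g f) \<subseteq> p ` ({tail G e, head G e} \<inter> {tail G f, head G f}))"

definition tame_embedding ::
    "('a, 'b) pre_digraph \<Rightarrow> ('a \<Rightarrow> real ^ 4) \<Rightarrow> ('b \<Rightarrow> real \<Rightarrow> real ^ 4) \<Rightarrow> bool" where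
  "tame_embedding G p g \<longleftrightarrow> graph_embedding G p g \<and> tame (graph_image G p g)"

text \<open>
  A \<open>pre_digraph.cycle\<close> is a nonempty list of arcs, each starting where the previous one ends, so it is
  consistently oriented; every vertex on it is the tail of one of its arcs.
\<close>

definition intrinsically_linked_digraph :: "('a, 'b) pre_digraph \<Rightarrow> bool" where
  "intrinsically_linked_digraph G \<longleftrightarrow>
     (\<forall>p g. tame_embedding G p g \<longrightarrow>
        (\<exists>c d. pre_digraph.cycle G c \<and> pre_digraph.cycle G d \<and>
           tail G ` set c \<inter> tail G ` set d = {} \<and>
           \<not> split_link (\<Union>e\<in>set c. path_image (g e)) (\<Union>e\<in>set d. path_image (g e))))"

end

theory Submission
  imports Defs
begin

text \<open>
  Two disjoint closed polygons in 3-space form a split link as soon as the convex hull of one of them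
  misses the other: the boundary of a slightly larger convex polytope is a tame sphere that separates
  them. It is therefore enough to place the eight vertices in 3-space and to draw all arcs as
  straight segments in such a way that, of any two disjoint directed cycles, the convex hull of one
  misses the other (\<open>not_linked_if_unpierced\<close>). For this only the vertex sets of the cycles matter.
  A set that carries a directed cycle is strongly connected, and this property does not see a reversal
  of all arcs. So the duals need no separate treatment.

  Each of the seven score sequences contains the score 1. Let \<open>v\<close> be a vertex of score 1 and
  let \<open>w\<close> be the vertex that it beats. A directed cycle through \<open>v\<close> also passes through \<open>w\<close>, so one
  of two disjoint cycles lies entirely in the tournament \<open>R\<close> on the other six vertices. Put
  \<open>v\<close>, \<open>w\<close> and the vertices \<open>r\<^sub>1, \<dots>, r\<^sub>6\<close> of \<open>R\<close>, in this order, on the moment curve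
  \<open>t \<mapsto> (t, t\<^sup>2, t\<^sup>3)\<close>. There the hull of a set \<open>B\<close> meets a segment \<open>a b\<close> only if \<open>B\<close> has
  elements before \<open>a\<close>, between \<open>a\<close> and \<open>b\<close>, and after \<open>b\<close> (\<open>moment_apart\<close>). If the other cycle
  takes up \<open>a\<close>, \<open>b\<close> and at least a third vertex, this leaves for the indices of \<open>B\<close> only 135, 136, 146,
  246, 1356, 1346 and 1246. Whenever each of these seven sets contains a vertex that beats all the
  others or loses to all of them, none of them carries a cycle, and no two disjoint cycles are linked.

  Reading \<open>R\<close> along a Hamiltonian path leaves ten arcs undetermined. Going through the \<open>2\<^sup>1\<^sup>0\<close> cases
  (\<open>settled_path_table\<close>) one finds that all but three isomorphism types of \<open>R\<close> have an order as above.
  One exception has a symmetry of order three, and it is handled by a placement with the same symmetry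
  (\<open>unlinked_if_rotational\<close>). For the other two exceptions, of scores (1,2,3,3,3,3) and (2,2,2,2,3,4),
  the cycle outside of \<open>B\<close> has to be used as well (\<open>unlinked_if_good_order\<close>): the score sequence of
  the whole tournament restricts which vertices of \<open>R\<close> are beaten by \<open>w\<close>, and hence which sets carry
  a cycle through \<open>w\<close>.
\<close>

section \<open>Splitting a link by a convex polytope\<close>

text \<open>
  The Minkowski sum of a polytope and a small box is again a polytope. It is where the
  separating sphere comes from.
\<close>

lemma polytope_neighbourhood:
  fixes K L :: "'a::euclidean_space set"
  assumes "polytope K" "closed L" "K \<inter> L = {}"
  obtains Q where "polytope Q" "K \<subseteq> interior Q" "Q \<inter> L = {}"
proof -
  obtain F where F: "finite F" "K = convex hull F"
    using assms(1) by (auto simp: polytope_def)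
  obtain \<delta> where \<delta>: "\<delta> > 0" "\<And>x y. x \<in> K \<Longrightarrow> y \<in> L \<Longrightarrow> \<delta> \<le> dist x y"
    using separate_compact_closed[OF polytope_imp_compact[OF assms(1)] assms(2,3)] by blast
  obtain a b :: 'a where ab: "0 \<in> box a b" "cbox a b \<subseteq> ball 0 \<delta>"
    using open_contains_cbox[of "ball 0 \<delta>" "0::'a"] \<delta>(1) by (metis centre_in_ball open_ball)
  obtain G where G: "finite G" "cbox a b = convex hull G"
    using closed_interval_as_convex_hull by metis
  define Q where "Q = K + cbox a b"
  have Q: "Q = convex hull (F + G)"
    unfolding Q_def F G by (simp add: convex_hull_set_plus)
  show thesis
  proof
    show "polytope Q" unfolding Q by (intro polytope_convex_hull finite_set_plus F G)
    show "K \<subseteq> interior Q"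
    proof
      fix x assume x: "x \<in> K"
      have "open ((+) x ` box a b)" by (rule open_translation) (rule open_box)
      moreover have "(+) x ` box a b \<subseteq> Q" using x box_subset_cbox by (fastforce simp: Q_def)
      moreover have "x \<in> (+) x ` box a b" using ab(1) by force
      ultimately show "x \<in> interior Q" by (meson interiorI)
    qed
    show "Q \<inter> L = {}"
    proof (rule ccontr)
      assume "Q \<inter> L \<noteq> {}"
      then obtain x y where "x \<in> K" "y \<in> cbox a b" "x + y \<in> L" by (auto simp: Q_def set_plus_def)
      then show False using \<delta>(2)[of x "x + y"] ab(2) by (auto simp: dist_norm subset_eq)
    qed
  qed
qed

lemma split_link_commute: "split_link K L \<longleftrightarrow> split_link L K"
  unfolding split_link_def by blast

text \<open>
  The inverse \<open>k\<close> of a fixed homeomorphism from the punctured 3-sphere to 3-space carries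
  everything that is built from straight segments into the 3-sphere. The same homeomorphism
  witnesses all the tameness claims.
\<close>

locale sphere_chart =
  fixes q :: "real ^ 4" and h :: "real ^ 4 \<Rightarrow> real ^ 3" and k :: "real ^ 3 \<Rightarrow> real ^ 4"
  assumes q: "q \<in> S3"
    and hk: "homeomorphism (S3 - {q}) UNIV h k"
begin

lemma h_k [simp]: "h (k x) = x"
  using hk by (auto simp: homeomorphism_def)

lemma inj_k: "inj k"
  by (metis h_k injI)

lemma k_eq_iff [simp]: "k x = k y \<longleftrightarrow> x = y"
  using inj_k by (simp add: inj_eq)

lemma k_in: "k x \<in> S3" "k x \<noteq> q"
proof -
  have "k x \<in> S3 - {q}" using hk unfolding homeomorphism_def by blast
  then show "k x \<in> S3" "k x \<noteq> q" by auto
qed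

lemma continuous_k: "continuous_on S k"
  using hk continuous_on_subset by (auto simp: homeomorphism_def)

lemma h_image_k [simp]: "h ` k ` X = X"
  by (simp add: image_image)

lemma tame_image:
  assumes "finite P" "\<And>C. C \<in> P \<Longrightarrow> polytope C"
  shows "tame (k ` \<Union>P)"
proof -
  have "k ` \<Union>P \<subseteq> S3" "q \<in> S3 - k ` \<Union>P" using k_in q by auto
  moreover have "h ` k ` \<Union>P = \<Union>P" by simp
  ultimately show ?thesis unfolding tame_def
    by (intro conjI exI[of _ q] exI[of _ h] exI[of _ k] exI[of _ P] ballI hk assms)
qed

text \<open>
  The separating sphere is the image of the frontier of a polytope \<open>Q\<close> around \<open>H\<close>. It is tame because
  the frontier is the union of the facets. Inside and outside are both open in the 3-sphere, so no
  component of the complement meets both.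
\<close>

lemma split_link_image:
  assumes H: "polytope H" "K \<subseteq> H" "H \<inter> L = {}"
    and K: "connected K" "K \<noteq> {}" and L: "closed L" "connected L" "L \<noteq> {}"
  shows "split_link (k ` K) (k ` L)"
proof -
  obtain Q where Q: "polytope Q" "H \<subseteq> interior Q" "Q \<inter> L = {}"
    using polytope_neighbourhood[OF H(1) L(1) H(3)] .
  have Qi: "interior Q \<noteq> {}" using K(2) H(2) Q(2) by auto
  have Qc: "convex Q" "compact Q" "closed Q" "bounded Q"
    using Q(1) by (simp_all add: polytope_imp_convex polytope_imp_compact polytope_imp_closed polytope_imp_bounded)
  have fr: "frontier Q = Q - interior Q"
    using Qc(3) by (simp add: frontier_def)
  have frel: "frontier Q = rel_frontier Q"
    using Qi by (simp add: rel_frontier_nonempty_interior)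
  define \<Sigma> where "\<Sigma> = k ` frontier Q"
  define U where "U = k ` interior Q"
  define V where "V = S3 - k ` Q"
  have "\<Sigma> homeomorphic frontier Q"
    unfolding \<Sigma>_def
    unfolding homeomorphic_def
    by (intro exI[of _ h] exI[of _ k] homeomorphism_of_subsets[OF hk, where T'' = UNIV])
      (use k_in in auto)
  also have "frontier Q homeomorphic rel_frontier (cball (0::real^3) 1)"
    unfolding frel
    by (rule homeomorphic_rel_frontiers_convex_bounded_sets)
      (use Qc Qi in \<open>auto simp: aff_dim_nonempty_interior aff_dim_cball\<close>)
  finally have \<Sigma>1: "\<Sigma> homeomorphic sphere (0::real^3) 1" by simp
  have "frontier Q = \<Union>{F. F facet_of Q}"
    unfolding frel using Q(1) by (simp add: rel_frontier_of_polyhedron polytope_imp_polyhedron)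
  then have \<Sigma>2: "tame \<Sigma>"
    unfolding \<Sigma>_def
    using tame_image[of "{F. F facet_of Q}"] finite_polytope_facets[OF Q(1)]
      face_of_polytope_polytope[OF Q(1) facet_of_imp_face_of] by auto
  have split: "S3 - \<Sigma> = U \<union> V" "U \<inter> V = {}"
    unfolding \<Sigma>_def U_def V_def fr using k_in interior_subset[of Q] by auto
  have "openin (top_of_set (S3 - {q})) U"
    unfolding U_def using homeomorphism_imp_open_map[OF homeomorphism_symD[OF hk], of "interior Q"] by simp
  then obtain U' where U': "open U'" "U = (S3 - {q}) \<inter> U'" by (auto simp: openin_open)
  have oU: "open (U' - {q})" using U'(1) by (simp add: open_delete)
  have oV: "open (- k ` Q)"
    using compact_continuous_image[OF continuous_k Qc(2)] compact_imp_closed by blast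
  obtain x y where xy: "x \<in> K" "y \<in> L" using K L by auto
  define C where "C = connected_component_set (S3 - \<Sigma>) (k x)"
  define D where "D = connected_component_set (S3 - \<Sigma>) (k y)"
  have KU: "k ` K \<subseteq> U" using H(2) Q(2) by (auto simp: U_def)
  have LV: "k ` L \<subseteq> V" using Q(3) k_in by (auto simp: V_def)
  have KC: "k ` K \<subseteq> C" unfolding C_def
    using xy KU split K by (intro connected_component_maximal connected_continuous_image continuous_k) auto
  have LD: "k ` L \<subseteq> D" unfolding D_def
    using xy LV split L by (intro connected_component_maximal connected_continuous_image continuous_k) auto
  have sub: "C \<subseteq> U \<union> V" unfolding C_def split(1)[symmetric] by (rule connected_component_subset)
  have "C \<noteq> D"
  proof
    assume eq: "C = D"
    have con: "connected C" by (simp add: C_def)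
    have "(U' - {q}) \<inter> C = {} \<or> (- k ` Q) \<inter> C = {}"
    proof (rule connectedD[OF con oU oV])
      show "(U' - {q}) \<inter> - k ` Q \<inter> C = {}" using sub split(2) U'(2) unfolding V_def by auto
      show "C \<subseteq> (U' - {q}) \<union> - k ` Q" using sub U'(2) unfolding V_def by auto
    qed
    moreover have "k x \<in> (U' - {q}) \<inter> C" using KU KC xy U'(2) by auto
    moreover have "k y \<in> - k ` Q \<inter> C" using LV LD xy eq by (auto simp: V_def)
    ultimately show False by blast
  qed
  moreover have "C \<in> components (S3 - \<Sigma>)" "D \<in> components (S3 - \<Sigma>)"
    unfolding C_def D_def by (intro componentsI; use KU LV xy split in auto)+
  ultimately show ?thesis
    unfolding split_link_def using \<Sigma>1 \<Sigma>2 KC LD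
    by (intro exI[of _ \<Sigma>] conjI bexI[of _ C] bexI[of _ D])
qed

end

lemma sphere_chart_exists: "\<exists>q h k. sphere_chart q h k"
proof -
  define q :: "real ^ 4" where "q = axis 1 1"
  have q: "q \<in> S3" by (simp add: q_def norm_axis_1)
  have "(S3 - {q}) homeomorphic (UNIV :: (real ^ 3) set)"
    using q by (intro homeomorphic_punctured_sphere_affine) auto
  then show ?thesis using q by (auto simp: homeomorphic_def sphere_chart_def)
qed

section \<open>Straight-line embeddings\<close>

definition apart :: "('a \<Rightarrow> real ^ 3) \<Rightarrow> 'a set \<Rightarrow> 'a set \<Rightarrow> bool" where
  "apart p A B \<longleftrightarrow> convex hull (p ` A) \<inter> convex hull (p ` B) = {}"

definition unpierced :: "('a \<Rightarrow> real ^ 3) \<Rightarrow> 'a set \<Rightarrow> 'a set \<Rightarrow> bool" where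
  "unpierced p A B \<longleftrightarrow> (\<forall>a\<in>B. \<forall>b\<in>B. apart p A {a, b})"

text \<open>
  The end points may coincide, so this also says that no vertex lies on a segment between two others
  and that the placement is injective.
\<close>

definition generic_on :: "'a set \<Rightarrow> ('a \<Rightarrow> real ^ 3) \<Rightarrow> bool" where
  "generic_on V p \<longleftrightarrow>
     (\<forall>a\<in>V. \<forall>b\<in>V. \<forall>c\<in>V. \<forall>d\<in>V. {a, b} \<inter> {c, d} = {} \<longrightarrow> apart p {a, b} {c, d})"

text \<open>
  Strong connectivity in the form in which it is refuted: a set \<open>A\<close> is not strong if one of
  its vertices beats no vertex of \<open>A\<close>, or if no arc leaves some proper nonempty part of \<open>A\<close>.
\<close>

definition strong :: "('a \<Rightarrow> 'a \<Rightarrow> bool) \<Rightarrow> 'a set \<Rightarrow> bool" where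
  "strong E A \<longleftrightarrow> A \<noteq> {} \<and> (\<forall>a\<in>A. \<exists>b\<in>A. E a b) \<and>
     (\<forall>X. X \<noteq> {} \<and> X \<subseteq> A \<and> (\<forall>x\<in>X. \<forall>y\<in>A. E x y \<longrightarrow> y \<in> X) \<longrightarrow> X = A)"

definition has_unlinked_placement :: "'a set \<Rightarrow> ('a \<Rightarrow> 'a \<Rightarrow> bool) \<Rightarrow> bool" where
  "has_unlinked_placement V E \<longleftrightarrow> (\<exists>p. generic_on V p \<and>
     (\<forall>A B. A \<subseteq> V \<and> B \<subseteq> V \<and> A \<inter> B = {} \<and> strong E A \<and> strong E B \<longrightarrow>
        unpierced p A B \<or> unpierced p B A))"

lemma closed_segments_share_end:
  fixes a b c :: "'a::real_vector"
  assumes "x \<in> closed_segment a b" "x \<in> closed_segment a c"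
    and "b \<notin> closed_segment a c" "c \<notin> closed_segment a b"
  shows "x = a"
proof (rule ccontr)
  assume "x \<noteq> a"
  obtain s t where s: "0 \<le> s" "s \<le> 1" "x = a + s *\<^sub>R (b - a)"
    and t: "0 \<le> t" "t \<le> 1" "x = a + t *\<^sub>R (c - a)"
    using assms(1,2) unfolding closed_segment_def
    by (smt (verit) mem_Collect_eq scaleR_left_diff_distrib scaleR_one scaleR_right_diff_distrib
        add_diff_eq diff_add_eq add.commute)
  have pos: "s > 0" "t > 0" using \<open>x \<noteq> a\<close> s t by (auto simp: less_le)
  have eq: "s *\<^sub>R (b - a) = t *\<^sub>R (c - a)" using s t by simp
  show False
  proof (cases "s \<le> t")
    case True
    have "(s / t) *\<^sub>R (b - a) = (1 / t) *\<^sub>R (s *\<^sub>R (b - a))" by simp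
    also have "\<dots> = c - a" unfolding eq using pos by simp
    finally have "c - a = (s / t) *\<^sub>R (b - a)" by simp
    then have "c = (1 - s / t) *\<^sub>R a + (s / t) *\<^sub>R b" by (simp add: algebra_simps)
    moreover have "0 \<le> s / t" "s / t \<le> 1" using True pos by auto
    ultimately show False using assms(4) unfolding in_segment by blast
  next
    case False
    have "(t / s) *\<^sub>R (c - a) = (1 / s) *\<^sub>R (t *\<^sub>R (c - a))" by simp
    also have "\<dots> = b - a" unfolding eq[symmetric] using pos by simp
    finally have "b - a = (t / s) *\<^sub>R (c - a)" by simp
    then have "b = (1 - t / s) *\<^sub>R a + (t / s) *\<^sub>R c" by (simp add: algebra_simps)
    moreover have "0 \<le> t / s" "t / s \<le> 1" using False pos by auto
    ultimately show False using assms(3) unfolding in_segment by blast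
  qed
qed

lemma apart_singletons: "apart p {a} {b} \<longleftrightarrow> p a \<noteq> p b"
  by (auto simp: apart_def)

lemma generic_on_inj:
  assumes "generic_on V p"
  shows "inj_on p V"
proof (rule inj_onI, rule ccontr)
  fix a b assume ab: "a \<in> V" "b \<in> V" "p a = p b" "a \<noteq> b"
  then have "apart p {a, a} {b, b}" using assms unfolding generic_on_def by blast
  with ab show False by (simp add: apart_singletons)
qed

lemma (in pre_digraph) cas_heads:
  assumes "cas u c v"
  shows "head G ` set c \<subseteq> insert v (tail G ` set c)" "c \<noteq> [] \<Longrightarrow> u \<in> tail G ` set c"
proof -
  show "head G ` set c \<subseteq> insert v (tail G ` set c)"
    using assms
  proof (induction c arbitrary: u)
    case (Cons e es)
    then have *: "cas (head G e) es v" by simp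
    have "head G e \<in> insert v (tail G ` set es)" using * by (cases es) auto
    then show ?case using Cons.IH[OF *] by auto
  qed simp
  show "u \<in> tail G ` set c" if "c \<noteq> []" using assms that by (cases c) auto
qed

lemma (in pre_digraph) cas_invariant:
  assumes "cas u c v" "u \<in> X" "\<And>e. e \<in> set c \<Longrightarrow> tail G e \<in> X \<Longrightarrow> head G e \<in> X"
  shows "tail G ` set c \<subseteq> X" "v \<in> X"
proof -
  have "tail G ` set c \<subseteq> X \<and> v \<in> X" using assms
  proof (induction c arbitrary: u)
    case (Cons e es)
    have "tail G ` set es \<subseteq> X \<and> v \<in> X"
      by (rule Cons.IH[of "head G e"]) (use Cons.prems in auto)
    then show ?case using Cons.prems by auto
  qed simp
  then show "tail G ` set c \<subseteq> X" "v \<in> X" by auto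
qed

lemma (in pre_digraph) cas_connected:
  fixes p :: "'a \<Rightarrow> 'c::real_normed_vector"
  assumes "cas u c v" "c \<noteq> []"
  shows "connected (\<Union>e\<in>set c. closed_segment (p (tail G e)) (p (head G e)))
    \<and> p u \<in> (\<Union>e\<in>set c. closed_segment (p (tail G e)) (p (head G e)))"
  using assms
proof (induction c arbitrary: u)
  case (Cons e es)
  show ?case
  proof (cases "es = []")
    case True
    then show ?thesis using Cons.prems by auto
  next
    case False
    then have IH: "connected (\<Union>e\<in>set es. closed_segment (p (tail G e)) (p (head G e)))"
      "p (head G e) \<in> (\<Union>e\<in>set es. closed_segment (p (tail G e)) (p (head G e)))"
      using Cons by auto
    have "connected (closed_segment (p (tail G e)) (p (head G e)) \<union>
        (\<Union>e\<in>set es. closed_segment (p (tail G e)) (p (head G e))))"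
      by (rule connected_Un) (use IH in auto)
    then show ?thesis using Cons.prems by auto
  qed
qed simp

lemma (in pre_digraph) cas_invariant_last:
  assumes "cas u c v" "\<And>e. e \<in> set c \<Longrightarrow> tail G e \<in> X \<Longrightarrow> head G e \<in> X"
    and "tail G ` set c \<inter> X \<noteq> {}"
  shows "v \<in> X"
  using assms
proof (induction c arbitrary: u)
  case (Cons e es)
  show ?case
  proof (cases "tail G e \<in> X")
    case True
    then show ?thesis using cas_invariant(2)[of u "e # es" v X] Cons.prems by auto
  next
    case False
    then show ?thesis using Cons by (auto intro!: Cons.IH[of "head G e"])
  qed
qed simp

lemma (in pre_digraph) cycle_cas:
  assumes "cycle c"
  obtains u where "cas u c u" "c \<noteq> []" "set c \<subseteq> arcs G"
  using assms by (auto simp: cycle_def awalk_def)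

lemma (in wf_digraph) cycle_strong:
  assumes "cycle c"
  shows "strong (\<lambda>a b. (a, b) \<in> arcs_ends G) (tail G ` set c)" "tail G ` set c \<subseteq> verts G"
proof -
  obtain u where u: "cas u c u" "c \<noteq> []" "set c \<subseteq> arcs G"
    using cycle_cas[OF assms] .
  have heads: "head G ` set c \<subseteq> tail G ` set c" using cas_heads[OF u(1)] u(2) by auto
  show "tail G ` set c \<subseteq> verts G" using u(3) by auto
  show "strong (\<lambda>a b. (a, b) \<in> arcs_ends G) (tail G ` set c)"
    unfolding strong_def
  proof (intro conjI allI impI)
    show "tail G ` set c \<noteq> {}" using u(2) by simp
    show "\<forall>a\<in>tail G ` set c. \<exists>b\<in>tail G ` set c. (a, b) \<in> arcs_ends G"
      using heads u(3) by (fastforce simp: arcs_ends_conv)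
    fix X assume X: "X \<noteq> {} \<and> X \<subseteq> tail G ` set c \<and>
      (\<forall>x\<in>X. \<forall>y\<in>tail G ` set c. (x, y) \<in> arcs_ends G \<longrightarrow> y \<in> X)"
    have inv: "head G e \<in> X" if "e \<in> set c" "tail G e \<in> X" for e
    proof -
      have "(tail G e, head G e) \<in> arcs_ends G" "head G e \<in> tail G ` set c"
        using that heads u(3) by (auto simp: arcs_ends_conv)
      then show ?thesis using X that by blast
    qed
    have "u \<in> X" by (rule cas_invariant_last[OF u(1) inv]) (use X in auto)
    then have "tail G ` set c \<subseteq> X" by (rule cas_invariant(1)[OF u(1) _ inv])
    then show "X = tail G ` set c" using X by blast
  qed
qed

text \<open>
  The arcs are drawn as the images of straight segments. A cycle with vertex set \<open>A\<close> becomes a closed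
  polygon inside the hull of \<open>A\<close>, and every edge of a cycle with vertex set \<open>B\<close> is the segment between two
  points of \<open>B\<close>. So \<open>split_link_image\<close> applies to any two disjoint cycles.
\<close>

theorem not_linked_if_unpierced:
  assumes "tournament T" and placement: "has_unlinked_placement (verts T) (\<lambda>a b. (a, b) \<in> arcs_ends T)"
  shows "\<not> intrinsically_linked_digraph T"
proof -
  obtain p where gen: "generic_on (verts T) p"
    and unp: "\<forall>A B. A \<subseteq> verts T \<and> B \<subseteq> verts T \<and> A \<inter> B = {} \<and>
        strong (\<lambda>a b. (a, b) \<in> arcs_ends T) A \<and> strong (\<lambda>a b. (a, b) \<in> arcs_ends T) B \<longrightarrow>
        unpierced p A B \<or> unpierced p B A"
    using placement unfolding has_unlinked_placement_def by (elim exE conjE)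
  interpret tournament T by fact
  obtain q h k where "sphere_chart q h k" using sphere_chart_exists by blast
  then interpret sphere_chart q h k .
  define seg where "seg = (\<lambda>e. closed_segment (p (tail T e)) (p (head T e)))"
  define g where "g = (\<lambda>e. k \<circ> linepath (p (tail T e)) (p (head T e)))"
  have inj: "inj_on p (verts T)" using generic_on_inj[OF gen] .
  have pim: "path_image (g e) = k ` seg e" for e
    by (simp add: g_def seg_def path_image_compose)
  have apart_segs: "closed_segment (p a) (p b) \<inter> closed_segment (p c) (p d) = {}"
    if "a \<in> verts T" "b \<in> verts T" "c \<in> verts T" "d \<in> verts T" "{a, b} \<inter> {c, d} = {}" for a b c d
    using gen that by (auto simp: generic_on_def apart_def segment_convex_hull)
  have off: "p c \<notin> closed_segment (p a) (p b)"
    if "a \<in> verts T" "b \<in> verts T" "c \<in> verts T" "c \<noteq> a" "c \<noteq> b" for a b c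
    using apart_segs[of a b c c] that by auto
  have ends: "{tail T e, head T e} \<noteq> {tail T f, head T f}" if "e \<in> arcs T" "f \<in> arcs T" "e \<noteq> f" for e f
  proof
    assume "{tail T e, head T e} = {tail T f, head T f}"
    then consider "tail T e = tail T f" "head T e = head T f" | "tail T e = head T f" "head T e = tail T f"
      by (auto simp: doubleton_eq_iff)
    then show False
    proof cases
      case 1 then show ?thesis using no_multi_arcs that by (auto simp: arc_to_ends_def)
    next
      case 2
      have "(tail T e, head T e) \<in> arcs_ends T" "(tail T f, head T f) \<in> arcs_ends T"
        using that(1,2) by (simp_all add: arcs_ends_conv)
      then have "(tail T e, head T e) \<in> arcs_ends T" "(head T e, tail T e) \<in> arcs_ends T"
        using 2 by simp_all
      then show ?thesis using exactly_one_arc[of "tail T e" "head T e"] no_loops[of e] that by auto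
    qed
  qed
  have img: "graph_image T (k \<circ> p) g = k ` \<Union>((\<lambda>v. {p v}) ` verts T \<union> seg ` arcs T)"
    unfolding graph_image_def pim by auto
  have emb: "graph_embedding T (k \<circ> p) g"
    unfolding graph_embedding_def
  proof (intro conjI ballI impI)
    show "inj_on (k \<circ> p) (verts T)" using inj inj_k by (simp add: inj_on_def)
    show "graph_image T (k \<circ> p) g \<subseteq> S3" unfolding img using k_in by blast
    fix e assume e: "e \<in> arcs T"
    have ne: "p (tail T e) \<noteq> p (head T e)" using inj e no_loops[OF e] by (auto dest: inj_onD)
    show "simple_path (g e)" unfolding g_def
      using ne by (intro simple_path_continuous_image continuous_k inj_on_subset[OF inj_k]) auto
    show "pathstart (g e) = (k \<circ> p) (tail T e)" "pathfinish (g e) = (k \<circ> p) (head T e)"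
      by (auto simp: g_def pathstart_compose pathfinish_compose)
    show "v \<in> {tail T e, head T e}" if "v \<in> verts T" "(k \<circ> p) v \<in> path_image (g e)" for v
    proof -
      have "p v \<in> closed_segment (p (tail T e)) (p (head T e))" using that(2) by (auto simp: pim seg_def)
      then show ?thesis using off[OF tail_in_verts[OF e] head_in_verts[OF e] that(1)] by blast
    qed
    show "path_image (g e) \<inter> path_image (g f)
        \<subseteq> (k \<circ> p) ` ({tail T e, head T e} \<inter> {tail T f, head T f})" if f: "f \<in> arcs T" "e \<noteq> f" for f
    proof -
      have share: "seg e \<inter> seg f \<subseteq> {p a}"
        if abc: "{tail T e, head T e} = {a, b}" "{tail T f, head T f} = {a, c}" for a b c
      proof -
        have v: "a \<in> verts T" "b \<in> verts T" "c \<in> verts T" using abc e f(1) by (auto simp: doubleton_eq_iff)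
        have ne: "b \<noteq> a" "c \<noteq> a" using abc no_loops[OF e] no_loops[OF f(1)] by (auto simp: doubleton_eq_iff)
        have "b \<noteq> c" using ends[OF e f] abc by auto
        have "seg e = closed_segment (p a) (p b)" "seg f = closed_segment (p a) (p c)"
          using abc by (auto simp: seg_def doubleton_eq_iff closed_segment_commute)
        then show ?thesis
          using closed_segments_share_end[of _ "p a" "p b" "p c"] off[of a c b] off[of a b c] v ne \<open>b \<noteq> c\<close> by auto
      qed
      have "seg e \<inter> seg f \<subseteq> p ` ({tail T e, head T e} \<inter> {tail T f, head T f})"
      proof (cases "{tail T e, head T e} \<inter> {tail T f, head T f} = {}")
        case True
        then show ?thesis using apart_segs[of "tail T e" "head T e" "tail T f" "head T f"] e f(1)
          by (simp add: seg_def)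
      next
        case False
        then obtain a where a: "a \<in> {tail T e, head T e} \<inter> {tail T f, head T f}" by blast
        then obtain b c where "{tail T e, head T e} = {a, b}" "{tail T f, head T f} = {a, c}"
          by (metis IntD1 IntD2 insert_commute insert_iff singletonD)
        from share[OF this] a show ?thesis by blast
      qed
      then show ?thesis unfolding pim by (auto simp: image_iff)
    qed
  qed
  have tame: "tame (graph_image T (k \<circ> p) g)"
    unfolding img
    by (rule tame_image) (auto simp: seg_def polytope_sing segment_convex_hull intro!: polytope_convex_hull)
  have cyc: "connected (\<Union>e\<in>set c. seg e)" "(\<Union>e\<in>set c. seg e) \<noteq> {}" "closed (\<Union>e\<in>set c. seg e)"
      "(\<Union>e\<in>set c. seg e) \<subseteq> convex hull (p ` tail T ` set c)"
      "e \<in> set c \<Longrightarrow> head T e \<in> tail T ` set c"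
    if "cycle c" for c e
  proof -
    obtain u where u: "cas u c u" "c \<noteq> []" "set c \<subseteq> arcs T" using cycle_cas[OF \<open>cycle c\<close>] .
    show "connected (\<Union>e\<in>set c. seg e)" "(\<Union>e\<in>set c. seg e) \<noteq> {}"
      using cas_connected[OF u(1,2), of p] by (auto simp: seg_def)
    show "closed (\<Union>e\<in>set c. seg e)" by (auto simp: seg_def)
    show heads: "head T e \<in> tail T ` set c" if "e \<in> set c" for e
      using that cas_heads[OF u(1)] u(2) by auto
    show "(\<Union>e\<in>set c. seg e) \<subseteq> convex hull (p ` tail T ` set c)"
    proof (rule UN_least)
      fix e assume "e \<in> set c"
      then have "{p (tail T e), p (head T e)} \<subseteq> p ` tail T ` set c" using heads by blast
      then show "seg e \<subseteq> convex hull (p ` tail T ` set c)"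
        unfolding seg_def segment_convex_hull by (rule hull_mono)
    qed
  qed
  have split: "split_link (\<Union>e\<in>set c. path_image (g e)) (\<Union>e\<in>set d. path_image (g e))"
    if cd: "cycle c" "cycle d" "unpierced p (tail T ` set c) (tail T ` set d)" for c d
  proof -
    have "convex hull (p ` tail T ` set c) \<inter> seg e = {}" if "e \<in> set d" for e
    proof -
      have "tail T e \<in> tail T ` set d" "head T e \<in> tail T ` set d" using that cyc(5)[OF cd(2)] by auto
      then have "apart p (tail T ` set c) {tail T e, head T e}" using cd(3) unfolding unpierced_def by blast
      then show ?thesis by (simp add: apart_def seg_def segment_convex_hull)
    qed
    then have "split_link (k ` (\<Union>e\<in>set c. seg e)) (k ` (\<Union>e\<in>set d. seg e))"
      using cyc[OF cd(1)] cyc[OF cd(2)]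
      by (intro split_link_image[of "convex hull (p ` tail T ` set c)"]) (auto simp: polytope_convex_hull)
    then show ?thesis by (simp add: pim image_UN)
  qed
  show ?thesis
  proof
    assume "intrinsically_linked_digraph T"
    then have "\<exists>c d. cycle c \<and> cycle d \<and> tail T ` set c \<inter> tail T ` set d = {} \<and>
        \<not> split_link (\<Union>e\<in>set c. path_image (g e)) (\<Union>e\<in>set d. path_image (g e))"
      using emb tame unfolding intrinsically_linked_digraph_def tame_embedding_def by simp
    then obtain c d where cd: "cycle c" "cycle d" "tail T ` set c \<inter> tail T ` set d = {}"
      "\<not> split_link (\<Union>e\<in>set c. path_image (g e)) (\<Union>e\<in>set d. path_image (g e))"
      by blast
    have "unpierced p (tail T ` set c) (tail T ` set d) \<or> unpierced p (tail T ` set d) (tail T ` set c)"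
      using unp cd(3) cycle_strong[OF cd(1)] cycle_strong[OF cd(2)] by simp
    then show False using split[OF cd(1,2)] split[OF cd(2,1)] cd(4) split_link_commute by metis
  qed
qed

lemma apartI:
  assumes "\<And>a. a \<in> A \<Longrightarrow> n \<bullet> p a > c" "\<And>b. b \<in> B \<Longrightarrow> n \<bullet> p b \<le> c"
  shows "apart p A B"
proof -
  have "convex hull (p ` A) \<subseteq> {x. n \<bullet> x > c}"
    by (rule hull_minimal) (use assms(1) in \<open>auto simp: convex_halfspace_gt\<close>)
  moreover have "convex hull (p ` B) \<subseteq> {x. n \<bullet> x \<le> c}"
    by (rule hull_minimal) (use assms(2) in \<open>auto simp: convex_halfspace_le\<close>)
  ultimately show ?thesis unfolding apart_def by force
qed

lemma apart_sym: "apart p A B \<longleftrightarrow> apart p B A"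
  by (auto simp: apart_def)

section \<open>The moment curve\<close>

definition moment :: "real \<Rightarrow> real ^ 3" where
  "moment t = vector [t, t\<^sup>2, t ^ 3]"

lemma inner_moment: "vector [a, b, c] \<bullet> moment t = a * t + b * t\<^sup>2 + c * t ^ 3"
  by (simp add: moment_def inner_vec_def sum_3)

text \<open>
  A polynomial of degree at most 3 on the moment curve is an affine function on 3-space. If \<open>B\<close> has no
  element before \<open>a\<close>, or none between \<open>a\<close> and \<open>b\<close>, or none after \<open>b\<close>, then one of the polynomials
  \<open>(u - s)(u - t)\<^sup>2\<close>, \<open>(u - s)(u - t)\<close>, \<open>(t - u)(u - s)\<^sup>2\<close>, where \<open>s\<close> and \<open>t\<close> are the parameters of
  \<open>a\<close> and \<open>b\<close>, is positive on \<open>B\<close> and vanishes at both ends of the segment.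
\<close>

lemma moment_apart:
  fixes pos :: "'a \<Rightarrow> real"
  assumes off: "\<And>x. x \<in> B \<Longrightarrow> pos x \<noteq> pos a \<and> pos x \<noteq> pos b" and ab: "pos a \<le> pos b"
    and no: "\<not> (\<exists>x\<in>B. \<exists>y\<in>B. \<exists>z\<in>B. pos x < pos a \<and> pos a < pos y \<and> pos y < pos b \<and> pos b < pos z)"
  shows "apart (moment \<circ> pos) B {a, b}"
proof -
  define s t where "s = pos a" and "t = pos b"
  have st: "s \<le> t" "\<And>x. x \<in> B \<Longrightarrow> pos x \<noteq> s \<and> pos x \<noteq> t"
    using off ab by (auto simp: s_def t_def)
  consider "\<And>x. x \<in> B \<Longrightarrow> pos x > s" | "\<And>x. x \<in> B \<Longrightarrow> pos x < s \<or> pos x > t" | "\<And>x. x \<in> B \<Longrightarrow> pos x < t"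
  proof (cases "(\<exists>x\<in>B. pos x < s) \<and> (\<exists>z\<in>B. pos z > t)")
    case True
    then have "pos y < s \<or> pos y > t" if "y \<in> B" for y
      using no st(2)[OF that] that unfolding s_def t_def by (meson linorder_neqE)
    then show ?thesis using that(2) by blast
  next
    case False
    then have "(\<forall>x\<in>B. pos x > s) \<or> (\<forall>x\<in>B. pos x < t)" using st(2) by (auto simp: not_less less_le)
    then show ?thesis using that(1,3) by blast
  qed
  then show ?thesis
  proof cases
    case 1
    have pos: "vector [2 * s * t + t\<^sup>2, - (s + 2 * t), 1] \<bullet> moment u - s * t\<^sup>2 = (u - s) * (u - t)\<^sup>2" for u
      by (simp add: inner_moment power2_eq_square power3_eq_cube algebra_simps)
    show ?thesis
    proof (rule apartI[where n = "vector [2 * s * t + t\<^sup>2, - (s + 2 * t), 1]" and c = "s * t\<^sup>2"])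
      fix x assume "x \<in> B"
      then have "(pos x - s) * (pos x - t)\<^sup>2 > 0" using 1 st by simp
      then have "vector [2 * s * t + t\<^sup>2, - (s + 2 * t), 1] \<bullet> moment (pos x) - (s * t\<^sup>2) > 0" unfolding pos .
      then show "vector [2 * s * t + t\<^sup>2, - (s + 2 * t), 1] \<bullet> (moment \<circ> pos) x > s * t\<^sup>2" by simp
    next
      fix x assume "x \<in> {a, b}"
      then have "(pos x - s) * (pos x - t)\<^sup>2 = 0" by (auto simp: s_def t_def)
      then have "vector [2 * s * t + t\<^sup>2, - (s + 2 * t), 1] \<bullet> moment (pos x) - (s * t\<^sup>2) = 0" unfolding pos .
      then show "vector [2 * s * t + t\<^sup>2, - (s + 2 * t), 1] \<bullet> (moment \<circ> pos) x \<le> s * t\<^sup>2" by simp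
    qed
  next
    case 2
    have pos: "vector [- (s + t), 1, 0] \<bullet> moment u - (- s * t) = (u - s) * (u - t)" for u
      by (simp add: inner_moment power2_eq_square algebra_simps)
    show ?thesis
    proof (rule apartI[where n = "vector [- (s + t), 1, 0]" and c = "- s * t"])
      fix x assume "x \<in> B"
      then have "(pos x - s) * (pos x - t) > 0" using 2[of x] st(1)
        by (auto simp: zero_less_mult_iff)
      then have "vector [- (s + t), 1, 0] \<bullet> moment (pos x) - (- s * t) > 0" unfolding pos .
      then show "vector [- (s + t), 1, 0] \<bullet> (moment \<circ> pos) x > - s * t" by simp
    next
      fix x assume "x \<in> {a, b}"
      then have "(pos x - s) * (pos x - t) = 0" by (auto simp: s_def t_def)
      then have "vector [- (s + t), 1, 0] \<bullet> moment (pos x) - (- s * t) = 0" unfolding pos .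
      then show "vector [- (s + t), 1, 0] \<bullet> (moment \<circ> pos) x \<le> - s * t" by simp
    qed
  next
    case 3
    have pos: "vector [- (2 * s * t + s\<^sup>2), 2 * s + t, - 1] \<bullet> moment u - (- t * s\<^sup>2) = (t - u) * (u - s)\<^sup>2" for u
      by (simp add: inner_moment power2_eq_square power3_eq_cube algebra_simps)
    show ?thesis
    proof (rule apartI[where n = "vector [- (2 * s * t + s\<^sup>2), 2 * s + t, - 1]" and c = "- t * s\<^sup>2"])
      fix x assume "x \<in> B"
      then have "(t - pos x) * (pos x - s)\<^sup>2 > 0" using 3 st by simp
      then have "vector [- (2 * s * t + s\<^sup>2), 2 * s + t, - 1] \<bullet> moment (pos x) - (- t * s\<^sup>2) > 0" unfolding pos .
      then show "vector [- (2 * s * t + s\<^sup>2), 2 * s + t, - 1] \<bullet> (moment \<circ> pos) x > - t * s\<^sup>2" by simp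
    next
      fix x assume "x \<in> {a, b}"
      then have "(t - pos x) * (pos x - s)\<^sup>2 = 0" by (auto simp: s_def t_def)
      then have "vector [- (2 * s * t + s\<^sup>2), 2 * s + t, - 1] \<bullet> moment (pos x) - (- t * s\<^sup>2) = 0" unfolding pos .
      then show "vector [- (2 * s * t + s\<^sup>2), 2 * s + t, - 1] \<bullet> (moment \<circ> pos) x \<le> - t * s\<^sup>2" by simp
    qed
  qed
qed

lemma moment_generic:
  fixes pos :: "'a \<Rightarrow> real"
  assumes "inj_on pos V"
  shows "generic_on V (moment \<circ> pos)"
  unfolding generic_on_def
proof (intro ballI impI)
  have *: "apart (moment \<circ> pos) {a, b} {c, d}"
    if "a \<in> V" "b \<in> V" "c \<in> V" "d \<in> V" "{a, b} \<inter> {c, d} = {}" "pos c \<le> pos d" for a b c d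
  proof (rule moment_apart)
    show "pos x \<noteq> pos c \<and> pos x \<noteq> pos d" if "x \<in> {a, b}" for x
      using that \<open>{a, b} \<inter> {c, d} = {}\<close> inj_onD[OF assms, of x c] inj_onD[OF assms, of x d]
        \<open>a \<in> V\<close> \<open>b \<in> V\<close> \<open>c \<in> V\<close> \<open>d \<in> V\<close> by blast
  qed (use that(6) in auto)
  fix a b c d assume abcd: "a \<in> V" "b \<in> V" "c \<in> V" "d \<in> V" "{a, b} \<inter> {c, d} = {}"
  show "apart (moment \<circ> pos) {a, b} {c, d}"
  proof (cases "pos c \<le> pos d")
    case True then show ?thesis using *[OF abcd] by simp
  next
    case False
    have "{a, b} \<inter> {d, c} = {}" using abcd(5) by auto
    with False show ?thesis using *[OF abcd(1,2,4,3)] by (simp add: insert_commute)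
  qed
qed

section \<open>Reversal and Hamiltonian paths\<close>

lemma strong_converse:
  assumes "strong E A"
  shows "strong (\<lambda>a b. E b a) A"
proof -
  have A: "A \<noteq> {}" "\<And>a. a \<in> A \<Longrightarrow> \<exists>b\<in>A. E a b"
    "\<And>X. X \<noteq> {} \<Longrightarrow> X \<subseteq> A \<Longrightarrow> \<forall>x\<in>X. \<forall>y\<in>A. E x y \<longrightarrow> y \<in> X \<Longrightarrow> X = A"
    using assms unfolding strong_def by blast+
  show ?thesis
    unfolding strong_def
  proof (intro conjI ballI allI impI)
    fix a assume a: "a \<in> A"
    show "\<exists>b\<in>A. E b a"
    proof (rule ccontr)
      assume none: "\<not> (\<exists>b\<in>A. E b a)"
      then have "A - {a} = {}" using A(3)[of "A - {a}"] a by blast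
      then show False using A(2)[OF a] none by blast
    qed
  next
    fix X assume X: "X \<noteq> {} \<and> X \<subseteq> A \<and> (\<forall>x\<in>X. \<forall>y\<in>A. E y x \<longrightarrow> y \<in> X)"
    show "X = A"
    proof (rule ccontr)
      assume "X \<noteq> A"
      then have "A - X \<noteq> {}" using X by blast
      then have "A - X = A" using A(3)[of "A - X"] X by blast
      then show False using X by blast
    qed
  qed (fact A(1))
qed

lemma strong_converse_iff: "strong (\<lambda>a b. E b a) A \<longleftrightarrow> strong E A"
  using strong_converse[of E A] strong_converse[of "\<lambda>a b. E b a" A] by blast

lemma has_unlinked_placement_converse:
  "has_unlinked_placement V (\<lambda>a b. E b a) \<longleftrightarrow> has_unlinked_placement V E"
proof -
  have "strong (\<lambda>a b. E b a) = strong E" by (rule ext) (rule strong_converse_iff)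
  then show ?thesis unfolding has_unlinked_placement_def by simp
qed

definition tournament_on :: "'a set \<Rightarrow> ('a \<Rightarrow> 'a \<Rightarrow> bool) \<Rightarrow> bool" where
  "tournament_on V E \<longleftrightarrow>
     (\<forall>a\<in>V. \<forall>b\<in>V. E a b \<longrightarrow> \<not> E b a) \<and> (\<forall>a\<in>V. \<forall>b\<in>V. a \<noteq> b \<longrightarrow> E a b \<or> E b a)"

text \<open>
  Redei's theorem, by inserting the vertices one by one. The condition on the first vertex
  keeps the induction going: if \<open>x\<close> beats the new vertex \<open>a\<close>, then \<open>x\<close> also beats the first vertex of
  the path into which \<open>a\<close> is inserted behind \<open>x\<close>.
\<close>

lemma hamiltonian_path_insert:
  assumes "successively E xs" "distinct xs" "a \<notin> set xs" "tournament_on (insert a (set xs)) E"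
  shows "\<exists>ys. successively E ys \<and> distinct ys \<and> set ys = insert a (set xs) \<and> hd ys \<in> {a, hd xs}"
  using assms
proof (induction xs)
  case Nil
  show ?case by (rule exI[of _ "[a]"]) simp
next
  case (Cons x xs)
  show ?case
  proof (cases "E a x")
    case True
    with Cons.prems(1-3) show ?thesis
      by (intro exI[of _ "a # x # xs"]) (simp add: insert_commute)
  next
    case False
    then have xa: "E x a" using Cons.prems(3,4) unfolding tournament_on_def by auto
    have suc: "successively E xs" using Cons.prems(1) unfolding successively_Cons by (elim disjE conjE) simp_all
    have tour: "tournament_on (insert a (set xs)) E"
      using Cons.prems(4) unfolding tournament_on_def by simp
    have "distinct xs" "a \<notin> set xs" using Cons.prems(2,3) by simp_all
    from Cons.IH[OF suc this tour]
    obtain ys where ys: "successively E ys" "distinct ys" "set ys = insert a (set xs)" "hd ys \<in> {a, hd xs}"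
      by blast
    have "ys \<noteq> []" using ys(3) by (metis empty_set insert_not_empty)
    then have hd: "hd ys \<in> insert a (set xs)" using hd_in_set ys(3) by metis
    have "E x (hd ys)"
    proof (cases "hd ys = a")
      case False
      then obtain z zs where "xs = z # zs" using hd by (cases xs) simp_all
      then show ?thesis using False ys(4) Cons.prems(1) by simp
    qed (use xa in simp)
    then have "successively E (x # ys)" using ys(1) \<open>ys \<noteq> []\<close> by (cases ys) simp_all
    moreover have "distinct (x # ys)" "set (x # ys) = insert a (set (x # xs))"
      using ys(2,3) Cons.prems(2,3) by (auto simp: insert_commute)
    ultimately show ?thesis by (intro exI[of _ "x # ys"]) simp_all
  qed
qed

lemma hamiltonian_path:
  assumes "finite V" "tournament_on V E"
  shows "\<exists>xs. successively E xs \<and> distinct xs \<and> set xs = V"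
  using assms
proof (induction V)
  case empty
  show ?case by (rule exI[of _ "[]"]) simp
next
  case (insert a V)
  have "tournament_on V E" using insert.prems unfolding tournament_on_def by auto
  then obtain xs where "successively E xs" "distinct xs" "set xs = V"
    using insert.IH by blast
  then have "\<exists>ys. successively E ys \<and> distinct ys \<and> set ys = insert a (set xs) \<and> hd ys \<in> {a, hd xs}"
    using insert.hyps insert.prems by (intro hamiltonian_path_insert) simp_all
  then show ?case unfolding \<open>set xs = V\<close> by blast
qed

section \<open>Orders of a tournament on six vertices\<close>

text \<open>
  A tournament on six named places is stored as a table of truth values in which every entry can be
  looked up in a single rewriting step, since many such tables are searched by rewriting.
\<close>

datatype place = P0 | P1 | P2 | P3 | P4 | P5

datatype 'b six = Six 'b 'b 'b 'b 'b 'b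

fun pick :: "'b six \<Rightarrow> place \<Rightarrow> 'b" where
  "pick (Six a b c d e f) P0 = a"
| "pick (Six a b c d e f) P1 = b"
| "pick (Six a b c d e f) P2 = c"
| "pick (Six a b c d e f) P3 = d"
| "pick (Six a b c d e f) P4 = e"
| "pick (Six a b c d e f) P5 = f"

definition places :: "place list" where
  "places = [P0, P1, P2, P3, P4, P5]"

definition entry :: "'b six six \<Rightarrow> place \<Rightarrow> place \<Rightarrow> 'b" where
  "entry t i j = pick (pick t i) j"

text \<open>
  The digraph that arises when the arc from \<open>v\<close> to \<open>w\<close> is contracted: \<open>None\<close> is the contracted vertex. Every
  place beats \<open>v\<close>, hence also \<open>None\<close>. The table \<open>s\<close> tells which places are beaten by \<open>w\<close>.
\<close>

fun contracted :: "bool six six \<Rightarrow> bool six \<Rightarrow> place option \<Rightarrow> place option \<Rightarrow> bool" where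
  "contracted t s None None = False"
| "contracted t s (Some i) None = True"
| "contracted t s None (Some j) = pick s j"
| "contracted t s (Some i) (Some j) = entry t i j"

text \<open>
  A source or a sink among the listed vertices. In the contracted digraph two vertices may
  beat each other, hence the additional condition on a source.
\<close>

definition extreme :: "('n \<Rightarrow> 'n \<Rightarrow> bool) \<Rightarrow> 'n list \<Rightarrow> bool" where
  "extreme H I \<longleftrightarrow>
     list_ex (\<lambda>s. list_all (\<lambda>x. x = s \<or> H s x \<and> \<not> H x s) I \<or> list_all (\<lambda>x. x = s \<or> \<not> H s x) I) I"

text \<open>
  All \<open>(x, a, y, b, z, r)\<close> such that \<open>x, a, y, b, z\<close> occur in this order in the given
  arrangement and \<open>r\<close> is the remaining place. On the moment curve the segment \<open>a b\<close> pierces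
  the triangle \<open>x y z\<close>.
\<close>

fun piercings :: "'n six \<Rightarrow> ('n \<times> 'n \<times> 'n \<times> 'n \<times> 'n \<times> 'n) list" where
  "piercings (Six a b c d e f) =
     [(a, b, c, d, e, f), (a, b, c, d, f, e), (a, b, c, e, f, d),
      (a, b, d, e, f, c), (a, c, d, e, f, b), (b, c, d, e, f, a)]"

text \<open>
  For an arrangement 1, ..., 6 the sets \<open>x y z\<close> and \<open>x y z r\<close> are the seven sets 135, 136, 146, 246, 1356, 1346 and
  1246 in which a cycle can be pierced.
\<close>

definition good_order :: "bool six six \<Rightarrow> place six \<Rightarrow> bool" where
  "good_order t ys \<longleftrightarrow> list_all (\<lambda>(x, a, y, b, z, r).
     extreme (entry t) [x, y, z] \<and> extreme (entry t) [x, y, z, r]) (piercings ys)"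

text \<open>
  The weaker condition also takes the second cycle into account. If the pierced cycle is \<open>x y z\<close>, the
  second one consists of \<open>a\<close> and \<open>b\<close> together with \<open>r\<close> or the contracted vertex or both. If the pierced
  cycle is \<open>x y z r\<close>, only the contracted vertex is left to complete \<open>a\<close> and \<open>b\<close>.
\<close>

definition good_order_with :: "bool six six \<Rightarrow> bool six \<Rightarrow> place six \<Rightarrow> bool" where
  "good_order_with t s ys \<longleftrightarrow> (let H = contracted t s in list_all (\<lambda>(x, a, y, b, z, r).
     (extreme H [Some x, Some y, Some z] \<or>
        extreme H [None, Some a, Some b] \<and> extreme H [Some a, Some b, Some r] \<and>
        extreme H [None, Some a, Some b, Some r]) \<and>
     (extreme H [Some x, Some y, Some z, Some r] \<or> extreme H [None, Some a, Some b])) (piercings ys))"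

fun is_order :: "place six \<Rightarrow> bool" where
  "is_order (Six a b c d e f) \<longleftrightarrow> distinct [a, b, c, d, e, f]"

lemma UNIV_place: "UNIV = {P0, P1, P2, P3, P4, P5}"
  by (auto intro: place.exhaust)

lemma range_place: "range f = {f P0, f P1, f P2, f P3, f P4, f P5}"
  by (simp add: UNIV_place)

lemma card_place: "card (UNIV :: place set) = 6"
  by (simp add: UNIV_place)

instance place :: finite
  by standard (simp add: UNIV_place)

lemma is_order_UNIV: "is_order (Six a b c d e f) \<Longrightarrow> UNIV = {a, b, c, d, e, f}"
  by (rule card_subset_eq[symmetric]) (auto simp: card_place)

lemma piercing_UNIV:
  assumes "is_order ys" "(x, a, y, b, z, r) \<in> set (piercings ys)"
  shows "UNIV = {x, a, y, b, z, r}" "distinct [x, a, y, b, z, r]"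
proof -
  obtain y1 y2 y3 y4 y5 y6 where ys: "ys = Six y1 y2 y3 y4 y5 y6" by (cases ys)
  have "UNIV = {y1, y2, y3, y4, y5, y6}" using is_order_UNIV assms(1) ys by blast
  then show "UNIV = {x, a, y, b, z, r}" using assms(2) unfolding ys by auto
  show "distinct [x, a, y, b, z, r]" using assms unfolding ys by auto
qed

lemma good_order_imp_with:
  assumes "good_order t ys"
  shows "good_order_with t s ys"
proof -
  have *: "extreme (contracted t s) (map Some I) \<longleftrightarrow> extreme (entry t) I" for I
    by (simp add: extreme_def list_all_iff list_ex_iff)
  have "extreme (contracted t s) [Some x, Some y, Some z] \<longleftrightarrow> extreme (entry t) [x, y, z]" for x y z
    using *[of "[x, y, z]"] by simp
  moreover have "extreme (contracted t s) [Some x, Some y, Some z, Some r] \<longleftrightarrow> extreme (entry t) [x, y, z, r]" for x y z r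
    using *[of "[x, y, z, r]"] by simp
  ultimately show ?thesis
    using assms unfolding good_order_def good_order_with_def Let_def list_all_iff by auto
qed

section \<open>Tournaments with a vertex of score one\<close>

locale single_exit =
  fixes V :: "'a set" and E :: "'a \<Rightarrow> 'a \<Rightarrow> bool" and v w :: 'a and x :: "place \<Rightarrow> 'a"
    and t :: "bool six six" and s :: "bool six"
  assumes V: "V = insert v (insert w (range x))"
    and vw: "v \<noteq> w" and v_notin: "v \<notin> range x" and w_notin: "w \<notin> range x" and inj: "inj x"
    and tour: "tournament_on V E"
    and v_w: "E v w" and v_x: "\<And>i. \<not> E v (x i)"
    and t: "\<And>i j. entry t i j = E (x i) (x j)"
    and s: "\<And>j. pick s j = E w (x j)"
begin

lemma x_eq_iff [simp]: "x i = x j \<longleftrightarrow> i = j"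
  using inj by (simp add: inj_eq)

lemma distinct_nodes [simp]: "v \<noteq> x i" "x i \<noteq> v" "w \<noteq> x i" "x i \<noteq> w" "v \<noteq> w" "w \<noteq> v"
  using v_notin w_notin vw by auto

lemma in_V [simp]: "v \<in> V" "w \<in> V" "x i \<in> V"
  by (auto simp: V)

lemma asym: "a \<in> V \<Longrightarrow> b \<in> V \<Longrightarrow> E a b \<Longrightarrow> \<not> E b a"
  using tour unfolding tournament_on_def by blast

lemma irrefl: "a \<in> V \<Longrightarrow> \<not> E a a"
  using asym by blast

lemma w_v: "\<not> E w v"
  using asym v_w by simp

lemma strong_exit:
  assumes "strong E A" "A \<subseteq> V" "v \<in> A"
  shows "w \<in> A"
proof -
  obtain b where "b \<in> A" "E v b" using assms unfolding strong_def by blast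
  then show ?thesis using assms(2) v_x irrefl[of v] by (auto simp: V)
qed

lemma not_strong_pair:
  assumes "a \<in> V" "b \<in> V"
  shows "\<not> strong E {a, b}"
proof
  assume "strong E {a, b}"
  then have "\<exists>c\<in>{a, b}. E a c" "\<exists>c\<in>{a, b}. E b c" unfolding strong_def by blast+
  then show False using asym irrefl assms by blast
qed

text \<open>
  A source or a sink of the contracted digraph remains an obstacle to strong connectivity in the
  tournament itself. Every place beats \<open>None\<close>, so if a place is a sink, then \<open>w\<close> and with it \<open>v\<close> are absent
  from \<open>A\<close>. If a place is a source and \<open>w\<close> lies in \<open>A\<close>, then \<open>w\<close> does not beat that place, and \<open>v\<close> beats no
  place at all. If \<open>None\<close> is a sink, then \<open>w\<close> beats nothing in \<open>A\<close>, and if \<open>None\<close> is a source, then \<open>A\<close> contains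
  no place.
\<close>

lemma strong_not_extreme:
  assumes st: "strong E A" and AV: "A \<subseteq> V" and I: "A - {v} = case_option w x ` set I"
  shows "\<not> extreme (contracted t s) I"
proof
  assume "extreme (contracted t s) I"
  then obtain m where m: "m \<in> set I"
    and mm: "(\<forall>n\<in>set I. n = m \<or> contracted t s m n \<and> \<not> contracted t s n m) \<or>
      (\<forall>n\<in>set I. n = m \<or> \<not> contracted t s m n)"
    unfolding extreme_def list_ex_iff list_all_iff by blast
  define a where "a = case_option w x m"
  have aA: "a \<in> A" using m I a_def by blast
  have out: "\<exists>b\<in>A. E c b" if "c \<in> A" for c using st that unfolding strong_def by blast
  have closed: "X = A" if "X \<noteq> {}" "X \<subseteq> A" "\<And>c d. c \<in> X \<Longrightarrow> d \<in> A \<Longrightarrow> E c d \<Longrightarrow> d \<in> X" for X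
    using st that unfolding strong_def by blast
  have xI: "Some j \<in> set I" if "x j \<in> A" for j
  proof -
    have "x j \<in> case_option w x ` set I" using that I by auto
    then obtain n where n: "n \<in> set I" "x j = case_option w x n" by blast
    have "n = Some j" using n(2) by (cases n) simp_all
    then show ?thesis using n(1) by simp
  qed
  have wI: "None \<in> set I" if "w \<in> A"
  proof -
    have "w \<in> case_option w x ` set I" using that I by auto
    then obtain n where n: "n \<in> set I" "w = case_option w x n" by blast
    have "n = None" using n(2) by (cases n) simp_all
    then show ?thesis using n(1) by simp
  qed
  from mm show False
  proof
    assume source: "\<forall>n\<in>set I. n = m \<or> contracted t s m n \<and> \<not> contracted t s n m"
    show False
    proof (cases m)
      case None
      have "x j \<notin> A" for j using source xI[of j] None by auto
      then have "A \<subseteq> {v, w}" using AV by (auto simp: V)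
      then show False using out[OF aA] None w_v irrefl[of w] by (auto simp: a_def)
    next
      case (Some i)
      have into: "\<not> E b a" if "b \<in> A" for b
      proof -
        consider "b = v" | "b = w" | j where "b = x j" using \<open>b \<in> A\<close> AV by (auto simp: V)
        then show ?thesis
        proof cases
          case 1 then show ?thesis using v_x Some by (simp add: a_def)
        next
          case 2 then show ?thesis using source wI that Some s[of i] by (auto simp: a_def)
        next
          case (3 j)
          then show ?thesis using source xI[of j] that Some t[of j i] irrefl[of "x i"] by (auto simp: a_def)
        qed
      qed
      obtain b where b: "b \<in> A" "E a b" using out[OF aA] by blast
      then have "b \<noteq> a" using into by blast
      have "A - {a} = A" by (rule closed) (use b \<open>b \<noteq> a\<close> into in auto)
      then show False using aA by blast
    qed
  next
    assume sink: "\<forall>n\<in>set I. n = m \<or> \<not> contracted t s m n"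
    obtain b where b: "b \<in> A" "E a b" using out[OF aA] by blast
    show False
    proof (cases m)
      case None
      then have "a = w" by (simp add: a_def)
      consider "b = v" | "b = w" | j where "b = x j" using \<open>b \<in> A\<close> AV by (auto simp: V)
      then show False
      proof cases
        case (3 j)
        then show ?thesis using sink xI[of j] b None s[of j] by (auto simp: a_def)
      qed (use b \<open>a = w\<close> w_v irrefl[of w] in auto)
    next
      case (Some i)
      have "w \<notin> A" using sink wI Some by auto
      then have "v \<notin> A" using strong_exit[OF st AV] by blast
      then obtain j where "b = x j" using b(1) \<open>w \<notin> A\<close> AV by (auto simp: V)
      then show False using sink xI[of j] b Some t[of i j] irrefl[of "x i"] by (auto simp: a_def)
    qed
  qed
qed

lemma has_unlinked_placementI:
  assumes "generic_on V p"
    and main: "\<And>A B. A \<subseteq> V \<Longrightarrow> strong E A \<Longrightarrow> B \<subseteq> V \<Longrightarrow> strong E B \<Longrightarrow> w \<notin> B \<Longrightarrow> v \<notin> B \<Longrightarrow> A \<inter> B = {} \<Longrightarrow>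
      unpierced p B A"
  shows "has_unlinked_placement V E"
  unfolding has_unlinked_placement_def
proof (intro exI[of _ p] conjI allI impI)
  show "generic_on V p" by fact
  have *: "unpierced p B A"
    if "A \<subseteq> V" "strong E A" "B \<subseteq> V" "strong E B" "w \<notin> B" "A \<inter> B = {}" for A B
    using main[OF that(1-5) _ that(6)] strong_exit[OF that(4,3)] that(5) by blast
  fix A B assume AB: "A \<subseteq> V \<and> B \<subseteq> V \<and> A \<inter> B = {} \<and> strong E A \<and> strong E B"
  show "unpierced p A B \<or> unpierced p B A"
  proof (cases "w \<in> B")
    case True
    then have "w \<notin> A" using AB by blast
    then show ?thesis using *[of B A] AB by blast
  next
    case False
    then show ?thesis using *[of A B] AB by blast
  qed
qed

text \<open>
  Apart from the six places, the cycles can only use \<open>v\<close> and \<open>w\<close>, which do not occur in \<open>B\<close>. So \<open>B\<close> and \<open>A - {v}\<close> are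
  determined by where \<open>r\<close> and \<open>w\<close> belong, and \<open>good_order_with\<close> covers all cases except \<open>A = {a, b}\<close>.
\<close>

lemma no_piercing:
  assumes good: "good_order_with t s ys" "is_order ys" "(x1, a1, x2, a2, x3, r) \<in> set (piercings ys)"
    and A: "A \<subseteq> V" "strong E A" and B: "B \<subseteq> V" "strong E B" "w \<notin> B" and disj: "A \<inter> B = {}"
    and mem: "x x1 \<in> B" "x x2 \<in> B" "x x3 \<in> B" "x a1 \<in> A" "x a2 \<in> A"
  shows False
proof -
  have U: "UNIV = {x1, a1, x2, a2, x3, r}" and d: "distinct [x1, a1, x2, a2, x3, r]"
    using piercing_UNIV[OF good(2,3)] by auto
  have V': "V = {v, w, x x1, x a1, x x2, x a2, x x3, x r}"
    unfolding V U by auto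
  have vB: "v \<notin> B" using strong_exit[OF B(2,1)] B(3) by blast
  define H where "H = contracted t s"
  have g: "extreme H [Some x1, Some x2, Some x3] \<or>
        extreme H [None, Some a1, Some a2] \<and> extreme H [Some a1, Some a2, Some r] \<and>
        extreme H [None, Some a1, Some a2, Some r]"
      "extreme H [Some x1, Some x2, Some x3, Some r] \<or> extreme H [None, Some a1, Some a2]"
    using good(1,3) unfolding good_order_with_def Let_def list_all_iff H_def by fastforce+
  have neA: "\<not> extreme H I" if "A - {v} = case_option w x ` set I" for I
    unfolding H_def by (rule strong_not_extreme[OF A(2,1) that])
  have neB: "\<not> extreme H I" if "B = case_option w x ` set I" for I
    unfolding H_def by (rule strong_not_extreme[OF B(2,1)]) (use that vB in auto)
  have notA: "x x1 \<notin> A" "x x2 \<notin> A" "x x3 \<notin> A" and notB: "x a1 \<notin> B" "x a2 \<notin> B"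
    using disj mem by auto
  have vA: "v \<notin> A" if "w \<notin> A" using strong_exit[OF A(2,1)] that by blast
  have A_pair: "A \<noteq> {x a1, x a2}" using not_strong_pair[of "x a1" "x a2"] A(2) by auto
  show False
  proof (cases "x r \<in> B")
    case True
    have "B = {x x1, x x2, x x3, x r}" using B(1,3) vB mem notB True unfolding V' by blast
    then have "extreme H [None, Some a1, Some a2]"
      using g(2) neB[of "[Some x1, Some x2, Some x3, Some r]"] by auto
    moreover have "x r \<notin> A" using True disj by blast
    ultimately show False
    proof (cases "w \<in> A")
      case True
      have "A - {v} = {w, x a1, x a2}" using A(1) notA \<open>x r \<notin> A\<close> mem True unfolding V' by auto
      then show False using neA[of "[None, Some a1, Some a2]"] \<open>extreme H [None, Some a1, Some a2]\<close> by auto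
    next
      case False
      then have "A = {x a1, x a2}" using A(1) notA \<open>x r \<notin> A\<close> mem vA unfolding V' by blast
      then show False using A_pair by blast
    qed
  next
    case False
    have "B = {x x1, x x2, x x3}" using B(1,3) vB mem notB False unfolding V' by blast
    then have g': "extreme H [None, Some a1, Some a2]" "extreme H [Some a1, Some a2, Some r]"
        "extreme H [None, Some a1, Some a2, Some r]"
      using g(1) neB[of "[Some x1, Some x2, Some x3]"] by auto
    consider "w \<in> A" "x r \<in> A" | "w \<in> A" "x r \<notin> A" | "w \<notin> A" "x r \<in> A" | "w \<notin> A" "x r \<notin> A" by blast
    then show False
    proof cases
      case 1
      have "A - {v} = {w, x a1, x a2, x r}" using A(1) notA mem 1 unfolding V' by auto
      then show False using neA[of "[None, Some a1, Some a2, Some r]"] g'(3) by auto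
    next
      case 2
      have "A - {v} = {w, x a1, x a2}" using A(1) notA mem 2 unfolding V' by auto
      then show False using neA[of "[None, Some a1, Some a2]"] g'(1) by auto
    next
      case 3
      have "A - {v} = {x a1, x a2, x r}" using A(1) notA mem 3 vA unfolding V' by auto
      then show False using neA[of "[Some a1, Some a2, Some r]"] g'(2) by auto
    next
      case 4
      have "A = {x a1, x a2}" using A(1) notA mem 4 vA unfolding V' by blast
      then show False using A_pair by blast
    qed
  qed
qed

text \<open>
  The vertices are placed on the moment curve at 0 for \<open>v\<close>, at 1 for \<open>w\<close> and at 2, ..., 7 for the places
  in the given order. Nothing in \<open>B\<close> comes before \<open>v\<close> or \<open>w\<close>, so only segments between places can pierce \<open>B\<close>.
\<close>

theorem unlinked_if_good_order:
  assumes good: "good_order_with t s ys" "is_order ys"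
  shows "has_unlinked_placement V E"
proof -
  obtain y1 y2 y3 y4 y5 y6 where ys: "ys = Six y1 y2 y3 y4 y5 y6" by (cases ys)
  have d: "distinct [y1, y2, y3, y4, y5, y6]" using good(2) ys by simp
  have U: "UNIV = {y1, y2, y3, y4, y5, y6}" using is_order_UNIV good(2) ys by blast
  define rank :: "place \<Rightarrow> nat" where
    "rank = (\<lambda>i. if i = y1 then 2 else if i = y2 then 3 else if i = y3 then 4 else
       if i = y4 then 5 else if i = y5 then 6 else 7)"
  have rank: "rank y1 = 2" "rank y2 = 3" "rank y3 = 4" "rank y4 = 5" "rank y5 = 6" "rank y6 = 7"
    using d by (auto simp: rank_def)
  have rank_range: "2 \<le> rank i \<and> rank i \<le> 7" for i by (simp add: rank_def)
  have rank_eq: "rank i = 2 \<longleftrightarrow> i = y1" "rank i = 3 \<longleftrightarrow> i = y2" "rank i = 4 \<longleftrightarrow> i = y3"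
    "rank i = 5 \<longleftrightarrow> i = y4" "rank i = 6 \<longleftrightarrow> i = y5" "rank i = 7 \<longleftrightarrow> i = y6" for i
    using rank U UNIV_I[of i] by (auto simp: rank_def split: if_splits)
  have rank_inj: "i = j" if "rank i = rank j" for i j
  proof -
    have "rank i \<in> {2, 3, 4, 5, 6, 7}" using rank_range[of i] by auto
    then show ?thesis using that rank_eq[of i] rank_eq[of j] by auto
  qed
  define pos :: "'a \<Rightarrow> real" where
    "pos = (\<lambda>a. if a = v then 0 else if a = w then 1 else real (rank (inv x a)))"
  have pos: "pos v = 0" "pos w = 1" "pos (x i) = real (rank i)" for i
    using inj by (auto simp: pos_def)
  have pos_inj: "inj_on pos V"
  proof (rule inj_onI)
    fix a b assume "a \<in> V" "b \<in> V" "pos a = pos b"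
    then show "a = b"
      using rank_inj rank_range
      by (auto simp: V pos)
        (metis One_nat_def Suc_1 not_less_eq_eq le_numeral_extra(4) of_nat_1_eq_iff of_nat_eq_0_iff
          zero_neq_numeral le_0_eq)+
  qed
  define p where "p = moment \<circ> pos"
  show ?thesis
  proof (rule has_unlinked_placementI)
    show "generic_on V p" unfolding p_def by (rule moment_generic[OF pos_inj])
    fix A B assume A: "A \<subseteq> V" "strong E A" and B: "B \<subseteq> V" "strong E B" "w \<notin> B" and vB: "v \<notin> B"
      and disj: "A \<inter> B = {}"
    have one: "apart p B {a, b}" if ab: "a \<in> A" "b \<in> A" "pos a \<le> pos b" for a b
      unfolding p_def
    proof (rule moment_apart)
      show "pos c \<noteq> pos a \<and> pos c \<noteq> pos b" if "c \<in> B" for c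
        using that ab(1,2) disj A(1) B(1) inj_onD[OF pos_inj, of c a] inj_onD[OF pos_inj, of c b] by blast
      show "pos a \<le> pos b" by (fact ab(3))
      show "\<not> (\<exists>c\<in>B. \<exists>d\<in>B. \<exists>e\<in>B. pos c < pos a \<and> pos a < pos d \<and> pos d < pos b \<and> pos b < pos e)"
      proof
        assume "\<exists>c\<in>B. \<exists>d\<in>B. \<exists>e\<in>B. pos c < pos a \<and> pos a < pos d \<and> pos d < pos b \<and> pos b < pos e"
        then obtain c d e where cde: "c \<in> B" "d \<in> B" "e \<in> B" "pos c < pos a" "pos a < pos d" "pos d < pos b" "pos b < pos e"
          by blast
        have Bx: "\<exists>i. u = x i" if "u \<in> B" for u using that B(1,3) vB by (auto simp: V)
        obtain i1 i3 i5 where i: "c = x i1" "d = x i3" "e = x i5" using Bx cde(1-3) by metis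
        have "pos c \<ge> 2" using rank_range[of i1] by (simp add: i pos)
        then have "pos a > 2" "pos b > 2" using cde by linarith+
        then have "a \<noteq> v" "a \<noteq> w" "b \<noteq> v" "b \<noteq> w" by (auto simp: pos)
        moreover have "a \<in> V" "b \<in> V" using ab A(1) by blast+
        ultimately have "a \<in> range x" "b \<in> range x" unfolding V by blast+
        then obtain i2 i4 where j: "a = x i2" "b = x i4" by blast
        have lt: "rank i1 < rank i2" "rank i2 < rank i3" "rank i3 < rank i4" "rank i4 < rank i5"
          using cde unfolding i j pos by simp_all
        \<comment> \<open>five out of six positions, in increasing order\<close>
        have "(rank i1, rank i2, rank i3, rank i4, rank i5) \<in>
          {(2,3,4,5,6), (2,3,4,5,7), (2,3,4,6,7), (2,3,5,6,7), (2,4,5,6,7), (3,4,5,6,7)}"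
          using lt rank_range[of i1] rank_range[of i5] by simp presburger
        then have "\<exists>r. (i1, i2, i3, i4, i5, r) \<in> set (piercings ys)"
          unfolding ys by (auto simp: rank_eq)
        then obtain r where "(i1, i2, i3, i4, i5, r) \<in> set (piercings ys)" by blast
        from no_piercing[OF good this A B disj] show False using cde ab i j by blast
      qed
    qed
    show "unpierced p B A"
      unfolding unpierced_def
    proof (intro ballI)
      fix a b assume "a \<in> A" "b \<in> A"
      then show "apart p B {a, b}" using one[of a b] one[of b a] by (cases "pos a \<le> pos b") (auto simp: insert_commute)
    qed
  qed
qed

end

section \<open>The rotational tournament\<close>

text \<open>
  The exceptional tournament with a symmetry of order three: two cyclic triangles \<open>P0 P1 P2\<close> and
  \<open>P3 P4 P5\<close> with arcs from \<open>P0\<close> to \<open>P3\<close>, from \<open>P1\<close> to \<open>P4\<close> and from \<open>P2\<close> to \<open>P5\<close>, and all other arcs from the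
  second triangle to the first.
\<close>

definition rotational :: "bool six six" where
  "rotational = Six
     (Six False True False True False False)
     (Six False False True False True False)
     (Six True False False False False True)
     (Six False True True False True False)
     (Six True False True False False True)
     (Six True True False True False False)"

text \<open>
  Names for all eight vertices: \<open>None\<close> stands for \<open>v\<close> and \<open>Some None\<close> for \<open>w\<close>.
\<close>

type_synonym label = "place option option"

text \<open>
  The symmetry acts on 3-space by cyclic permutation of the coordinates, so \<open>v\<close> and \<open>w\<close> lie on
  the diagonal.
\<close>

fun site :: "label \<Rightarrow> int \<times> int \<times> int" where
  "site None = (3, 3, 3)"
| "site (Some None) = (2, 2, 2)"
| "site (Some (Some P0)) = (2, 0, 0)"
| "site (Some (Some P1)) = (0, 2, 0)"
| "site (Some (Some P2)) = (0, 0, 2)"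
| "site (Some (Some P3)) = (2, -2, -1)"
| "site (Some (Some P4)) = (-1, 2, -2)"
| "site (Some (Some P5)) = (-2, -1, 2)"

text \<open>
  Ten planes \<open>a x + b y + c z = d\<close> and their images under the symmetry. They suffice to separate all
  the pairs of convex hulls that have to be disjoint.
\<close>

definition planes :: "(int \<times> int \<times> int \<times> int) list" where
  "planes = concat (map (\<lambda>(a, b, c, d). [(a, b, c, d), (c, a, b, d), (b, c, a, d)])
     [(0, 0, -1, -2), (2, -3, -2, -5), (0, -1, -1, -2), (-3, -3, 2, -7), (-1, 2, -2, -3),
      (-1, 0, 0, 0), (-2, -1, 0, -4), (-2, 3, -4, -8), (0, -2, -1, -2), (-1, -1, 0, -4)])"

fun beyond :: "int \<times> int \<times> int \<times> int \<Rightarrow> label \<Rightarrow> bool" where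
  "beyond (a, b, c, d) l = (case site l of (x, y, z) \<Rightarrow> d < a * x + b * y + c * z)"

text \<open>
  The side on which a vertex lies is tabulated once for each plane, so that the search
  below does no arithmetic.
\<close>

definition tabulate :: "(label \<Rightarrow> bool) \<Rightarrow> bool \<times> bool \<times> bool six" where
  "tabulate f = (f None, f (Some None),
     Six (f (Some (Some P0))) (f (Some (Some P1))) (f (Some (Some P2)))
       (f (Some (Some P3))) (f (Some (Some P4))) (f (Some (Some P5))))"

fun look :: "bool \<times> bool \<times> bool six \<Rightarrow> label \<Rightarrow> bool" where
  "look (a, b, f) None = a"
| "look (a, b, f) (Some None) = b"
| "look (a, b, f) (Some (Some i)) = pick f i"

definition separated :: "(bool \<times> bool \<times> bool six) list \<Rightarrow> label list \<Rightarrow> label list \<Rightarrow> bool" where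
  "separated S I J \<longleftrightarrow> list_ex (\<lambda>f.
     list_all (look f) I \<and> list_all (\<lambda>j. \<not> look f j) J \<or>
     list_all (look f) J \<and> list_all (\<lambda>i. \<not> look f i) I) S"

definition labels :: "label list" where
  "labels = None # Some None # map (\<lambda>i. Some (Some i)) places"

fun pairs :: "'b list \<Rightarrow> ('b \<times> 'b) list" where
  "pairs [] = []"
| "pairs (x # xs) = map (Pair x) (x # xs) @ pairs xs"

definition sites_generic :: "(bool \<times> bool \<times> bool six) list \<Rightarrow> bool" where
  "sites_generic S \<longleftrightarrow> list_all (\<lambda>(a, b). list_all (\<lambda>(c, d).
     a = c \<or> a = d \<or> b = c \<or> b = d \<or> separated S [a, b] [c, d])
     (pairs labels)) (pairs labels)"

text \<open>
  As with \<open>good_order\<close>, the second cycle does not matter: every set of places that can carry a cycle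
  is unpierced by all segments between other vertices.
\<close>

definition sites_unpierced :: "(bool \<times> bool \<times> bool six) list \<Rightarrow> bool" where
  "sites_unpierced S \<longleftrightarrow> list_all (\<lambda>I. I = [] \<or> extreme (entry rotational) I \<or>
     (let J = map (\<lambda>i. Some (Some i)) I; K = filter (\<lambda>l. l \<notin> set J) labels in
       list_all (\<lambda>(a, b). separated S J [a, b]) (pairs K))) (subseqs places)"

lemma sites_generic: "sites_generic (map (\<lambda>f. tabulate (beyond f)) planes)"
  by code_simp

lemma sites_unpierced: "sites_unpierced (map (\<lambda>f. tabulate (beyond f)) planes)"
  by code_simp

definition point :: "int \<times> int \<times> int \<Rightarrow> real ^ 3" where
  "point = (\<lambda>(x, y, z). vector [of_int x, of_int y, of_int z])"

lemma look_tabulate [simp]: "look (tabulate f) l = f l"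
proof (cases l)
  case (Some m)
  then show ?thesis
  proof (cases m)
    case (Some i)
    with \<open>l = Some m\<close> show ?thesis by (cases i) (simp_all add: tabulate_def)
  qed (simp add: tabulate_def)
qed (simp add: tabulate_def)

lemma separated_apart:
  assumes "separated (map (\<lambda>f. tabulate (beyond f)) planes) I J"
  shows "apart (point \<circ> site) (set I) (set J)"
proof -
  obtain a b c d where f: "(\<forall>i\<in>set I. beyond (a, b, c, d) i) \<and> (\<forall>j\<in>set J. \<not> beyond (a, b, c, d) j) \<or>
      (\<forall>j\<in>set J. beyond (a, b, c, d) j) \<and> (\<forall>i\<in>set I. \<not> beyond (a, b, c, d) i)"
    using assms unfolding separated_def list_ex_iff list_all_iff by fastforce
  define n :: "real ^ 3" where "n = vector [of_int a, of_int b, of_int c]"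
  have *: "n \<bullet> (point \<circ> site) l > of_int d \<longleftrightarrow> beyond (a, b, c, d) l" for l
  proof (cases "site l")
    case (fields x y z)
    have "n \<bullet> (point \<circ> site) l = of_int (a * x + b * y + c * z)"
      using fields by (simp add: n_def point_def inner_vec_def sum_3)
    then show ?thesis using fields by (simp only: of_int_less_iff beyond.simps split_conv prod.case)
  qed
  have "apart (point \<circ> site) X Y" if "\<forall>i\<in>X. beyond (a, b, c, d) i" "\<forall>j\<in>Y. \<not> beyond (a, b, c, d) j" for X Y
    by (rule apartI[of _ "of_int d" n]) (use that * in \<open>auto simp: not_less[symmetric]\<close>)
  then show ?thesis using f apart_sym by metis
qed

lemma pairs_complete: "a \<in> set xs \<Longrightarrow> b \<in> set xs \<Longrightarrow> (a, b) \<in> set (pairs xs) \<or> (b, a) \<in> set (pairs xs)"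
  by (induction xs) auto

lemma filter_subseqs: "filter P xs \<in> set (subseqs xs)"
  by (induction xs) (auto simp: Let_def)

lemma set_places: "set places = UNIV"
  by (simp add: places_def UNIV_place)

lemma set_labels: "l \<in> set labels"
proof (cases l)
  case (Some m)
  then show ?thesis by (cases m) (auto simp: labels_def set_places)
qed (simp add: labels_def)

lemma sites_apart:
  assumes "{a, b} \<inter> {c, d} = {}"
  shows "apart (point \<circ> site) {a, b} {c, d}"
proof -
  have *: "apart (point \<circ> site) {a, b} {c, d}"
    if "(a, b) \<in> set (pairs labels)" "(c, d) \<in> set (pairs labels)" "{a, b} \<inter> {c, d} = {}" for a b c d
  proof -
    have "separated (map (\<lambda>f. tabulate (beyond f)) planes) [a, b] [c, d]"
      using sites_generic that unfolding sites_generic_def list_all_iff by fastforce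
    then show ?thesis using separated_apart[of "[a, b]" "[c, d]"] by simp
  qed
  from assms have "{b, a} \<inter> {c, d} = {}" "{a, b} \<inter> {d, c} = {}" "{b, a} \<inter> {d, c} = {}" by auto
  with assms show ?thesis
    using pairs_complete[OF set_labels set_labels, of a b] pairs_complete[OF set_labels set_labels, of c d]
      *[of a b c d] *[of b a c d] *[of a b d c] *[of b a d c]
    by (auto simp: insert_commute)
qed

context single_exit
begin

definition label_of :: "'a \<Rightarrow> label" where
  "label_of a = (if a = v then None else if a = w then Some None else Some (Some (inv x a)))"

lemma label_of_simps [simp]: "label_of v = None" "label_of w = Some None" "label_of (x i) = Some (Some i)"
  using inj by (auto simp: label_of_def)

lemma inj_label_of: "inj_on label_of V"
  by (auto simp: inj_on_def V)

lemma apart_label_of: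
  "apart (point \<circ> site \<circ> label_of) A B \<longleftrightarrow> apart (point \<circ> site) (label_of ` A) (label_of ` B)"
  by (simp add: apart_def image_comp)

theorem unlinked_if_rotational:
  assumes rot: "t = rotational"
  shows "has_unlinked_placement V E"
proof -
  define p where "p = point \<circ> site \<circ> label_of"
  have gen: "generic_on V p"
    unfolding generic_on_def
  proof (intro ballI impI)
    fix a b c d assume abcd: "a \<in> V" "b \<in> V" "c \<in> V" "d \<in> V" "{a, b} \<inter> {c, d} = {}"
    then have "label_of ` {a, b} \<inter> label_of ` {c, d} = {}"
      using inj_on_image_Int[OF inj_label_of, of "{a, b}" "{c, d}"] by auto
    then show "apart p {a, b} {c, d}" unfolding p_def apart_label_of using sites_apart by simp
  qed
  show ?thesis
  proof (rule has_unlinked_placementI)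
    show "generic_on V p" by (rule gen)
    fix A B assume A: "A \<subseteq> V" "strong E A" and B: "B \<subseteq> V" "strong E B" "w \<notin> B" and vB: "v \<notin> B"
      and disj: "A \<inter> B = {}"
    define I where "I = filter (\<lambda>i. x i \<in> B) places"
    have setI: "set I = {i. x i \<in> B}" by (simp add: I_def set_places)
    have BI: "B = x ` set I" unfolding setI using B(1,3) vB by (auto simp: V)
    have "I \<noteq> []" using B(2) BI unfolding strong_def by auto
    have "\<not> extreme (contracted t s) (map Some I)"
      by (rule strong_not_extreme[OF B(2,1)]) (use vB BI in \<open>auto simp: image_image\<close>)
    then have "\<not> extreme (entry t) I" by (simp add: extreme_def list_all_iff list_ex_iff)
    moreover have "I \<in> set (subseqs places)" unfolding I_def by (rule filter_subseqs)
    ultimately have sep: "\<And>a b. (a, b) \<in> set (pairs (filter (\<lambda>l. l \<notin> set (map (\<lambda>i. Some (Some i)) I)) labels)) \<Longrightarrow>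
        separated (map (\<lambda>f. tabulate (beyond f)) planes) (map (\<lambda>i. Some (Some i)) I) [a, b]"
      using sites_unpierced \<open>I \<noteq> []\<close> unfolding sites_unpierced_def list_all_iff rot Let_def by blast
    have lB: "label_of ` B = set (map (\<lambda>i. Some (Some i)) I)" unfolding BI by (auto simp: image_image)
    show "unpierced p B A"
      unfolding unpierced_def
    proof (intro ballI)
      fix a b assume ab: "a \<in> A" "b \<in> A"
      have K: "label_of c \<in> set (filter (\<lambda>l. l \<notin> set (map (\<lambda>i. Some (Some i)) I)) labels)" if "c \<in> A" for c
      proof -
        have "label_of c \<notin> label_of ` B"
          using that A(1) B(1) disj inj_on_image_mem_iff[OF inj_label_of, of c B] by blast
        then show ?thesis unfolding lB by (simp add: set_labels)
      qed
      have ap: "apart (point \<circ> site) (label_of ` B) {l, m}"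
        if "(l, m) \<in> set (pairs (filter (\<lambda>l. l \<notin> set (map (\<lambda>i. Some (Some i)) I)) labels))" for l m
        using separated_apart[OF sep[OF that]] unfolding lB by simp
      have "apart (point \<circ> site) (label_of ` B) {label_of a, label_of b}"
        using pairs_complete[OF K[OF ab(1)] K[OF ab(2)]]
      proof
        assume "(label_of b, label_of a) \<in> set (pairs (filter (\<lambda>l. l \<notin> set (map (\<lambda>i. Some (Some i)) I)) labels))"
        from ap[OF this] show ?thesis by (simp only: insert_commute)
      qed (rule ap)
      then show "apart p B {a, b}" unfolding p_def apart_label_of by simp
    qed
  qed
qed

end

section \<open>The finite search\<close>

text \<open>
  The tournaments on \<open>P0, ..., P5\<close> in which each place beats the next one. The
  arguments are the ten remaining arcs, where \<open>bij\<close> says that \<open>Pi\<close> beats \<open>Pj\<close>.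
\<close>

fun path_table :: "bool list \<Rightarrow> bool six six" where
  "path_table [b02, b03, b04, b05, b13, b14, b15, b24, b25, b35] = Six
     (Six False True b02 b03 b04 b05)
     (Six False False True b13 b14 b15)
     (Six (\<not> b02) False False True b24 b25)
     (Six (\<not> b03) (\<not> b13) False False True b35)
     (Six (\<not> b04) (\<not> b14) (\<not> b24) False False True)
     (Six (\<not> b05) (\<not> b15) (\<not> b25) (\<not> b35) False False)"
| "path_table _ = undefined"

fun six_of_list :: "'b list \<Rightarrow> 'b six" where
  "six_of_list [a, b, c, d, e, f] = Six a b c d e f"
| "six_of_list _ = undefined"

fun bit_lists :: "nat \<Rightarrow> bool list list" where
  "bit_lists 0 = [[]]"
| "bit_lists (Suc n) = map ((#) True) (bit_lists n) @ map ((#) False) (bit_lists n)"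

lemma bit_lists_complete: "length bs = n \<Longrightarrow> bs \<in> set (bit_lists n)"
proof (induction n arbitrary: bs)
  case (Suc n)
  then obtain b cs where "bs = b # cs" "length cs = n" by (auto simp: length_Suc_conv)
  then show ?case using Suc.IH[of cs] by (cases b) auto
qed simp

fun total :: "bool six \<Rightarrow> nat" where
  "total (Six a b c d e f) = of_bool a + of_bool b + of_bool c + of_bool d + of_bool e + of_bool f"

text \<open>
  The scores of \<open>v\<close>, of \<open>w\<close> and of the places. Every place beats \<open>v\<close>, and it beats \<open>w\<close> unless it is
  beaten by \<open>w\<close>.
\<close>

definition scores :: "bool six six \<Rightarrow> bool six \<Rightarrow> nat list" where
  "scores t s = 1 # total s # map (\<lambda>i. total (pick t i) + 1 + of_bool (\<not> pick s i)) places"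

definition score_lists :: "nat list list" where
  "score_lists = [[1,2,3,3,4,5,5,5], [1,3,3,3,4,4,4,6], [1,3,4,4,4,4,4,4], [1,2,3,3,4,4,5,6],
     [1,2,2,4,4,5,5,5], [1,2,4,4,4,4,4,5], [1,3,3,3,3,5,5,5]]"

definition rearrange :: "bool six six \<Rightarrow> place six \<Rightarrow> bool six six" where
  "rearrange t ys = map_six (\<lambda>i. map_six (entry t i) ys) ys"

text \<open>
  Each tournament with a Hamiltonian path along the places that is not of one of the three
  exceptional types has one of the following good orders.
\<close>

definition general_orders :: "place six list" where
  "general_orders = [
    Six P0 P4 P3 P2 P1 P5, Six P1 P0 P5 P2 P3 P4, Six P0 P5 P4 P1 P2 P3, Six P2 P1 P0 P4 P3 P5,
    Six P0 P4 P3 P1 P2 P5, Six P1 P0 P2 P3 P5 P4, Six P1 P0 P2 P4 P3 P5, Six P1 P2 P0 P5 P3 P4,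
    Six P2 P1 P0 P3 P5 P4, Six P0 P4 P5 P3 P2 P1, Six P0 P1 P5 P2 P3 P4, Six P1 P0 P2 P5 P4 P3,
    Six P0 P1 P2 P5 P3 P4, Six P0 P3 P1 P2 P5 P4, Six P3 P2 P4 P1 P0 P5, Six P0 P5 P1 P2 P4 P3,
    Six P1 P0 P5 P2 P4 P3, Six P3 P2 P1 P4 P0 P5, Six P0 P1 P3 P2 P4 P5, Six P0 P3 P2 P4 P5 P1,
    Six P0 P5 P1 P4 P3 P2, Six P1 P0 P5 P3 P2 P4, Six P2 P0 P1 P3 P4 P5, Six P0 P2 P5 P1 P4 P3,
    Six P3 P2 P0 P1 P5 P4, Six P1 P0 P4 P5 P3 P2, Six P1 P2 P5 P4 P0 P3, Six P2 P1 P4 P0 P3 P5,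
    Six P0 P2 P1 P3 P5 P4, Six P1 P2 P0 P3 P4 P5, Six P2 P1 P0 P5 P4 P3, Six P2 P1 P3 P0 P5 P4,
    Six P2 P1 P5 P0 P4 P3, Six P4 P3 P2 P0 P1 P5, Six P0 P1 P2 P4 P5 P3, Six P0 P1 P3 P5 P2 P4,
    Six P0 P2 P1 P5 P4 P3, Six P0 P2 P4 P1 P3 P5, Six P0 P3 P4 P2 P1 P5, Six P1 P3 P0 P2 P4 P5,
    Six P1 P3 P2 P0 P5 P4, Six P4 P0 P2 P3 P1 P5, Six P0 P2 P3 P4 P5 P1, Six P0 P2 P4 P5 P3 P1,
    Six P0 P3 P1 P5 P4 P2, Six P0 P3 P2 P1 P4 P5, Six P0 P3 P5 P2 P4 P1, Six P0 P4 P2 P3 P5 P1,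
    Six P1 P0 P3 P4 P5 P2, Six P1 P0 P3 P5 P4 P2, Six P1 P0 P5 P4 P3 P2, Six P1 P4 P0 P3 P5 P2,
    Six P2 P0 P1 P4 P3 P5, Six P2 P0 P1 P4 P5 P3, Six P2 P0 P4 P1 P5 P3, Six P3 P0 P2 P5 P1 P4,
    Six P3 P1 P0 P2 P5 P4, Six P3 P2 P1 P0 P5 P4, Six P4 P0 P1 P2 P3 P5, Six P4 P1 P3 P0 P2 P5,
    Six P4 P2 P0 P1 P3 P5]"

text \<open>
  Isomorphisms onto the rotational tournament, one for each of the fifteen ways in which it
  arises along a Hamiltonian path.
\<close>

definition rotational_orders :: "place six list" where
  "rotational_orders = [
    Six P0 P1 P2 P4 P5 P3, Six P0 P1 P3 P5 P2 P4, Six P0 P1 P5 P4 P2 P3, Six P0 P2 P4 P1 P3 P5,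
    Six P0 P4 P2 P1 P5 P3, Six P0 P4 P5 P1 P2 P3, Six P0 P5 P3 P1 P2 P4, Six P1 P2 P3 P5 P0 P4,
    Six P1 P3 P4 P2 P0 P5, Six P1 P3 P5 P2 P4 P0, Six P1 P5 P3 P2 P0 P4, Six P2 P3 P4 P0 P1 P5,
    Six P2 P4 P5 P3 P0 P1, Six P3 P4 P5 P0 P1 P2, Six P3 P4 P5 P1 P2 P0]"

text \<open>
  Orders for the other two exceptional types, for use with \<open>good_order_with\<close>.
\<close>

definition special_orders :: "place six list" where
  "special_orders = [
    Six P3 P2 P1 P4 P0 P5, Six P0 P1 P5 P2 P3 P4, Six P0 P3 P2 P4 P5 P1, Six P1 P4 P3 P0 P2 P5,
    Six P2 P1 P5 P3 P0 P4, Six P3 P5 P0 P1 P2 P4, Six P1 P4 P2 P5 P0 P3, Six P0 P2 P4 P5 P3 P1,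
    Six P0 P2 P5 P4 P1 P3, Six P2 P5 P3 P0 P1 P4, Six P0 P3 P1 P2 P5 P4, Six P0 P3 P1 P4 P2 P5]"

lemma are_orders: "list_all is_order (general_orders @ rotational_orders @ special_orders)"
  by code_simp

definition settled :: "bool list \<Rightarrow> bool" where
  "settled bs \<longleftrightarrow> (let t = path_table bs in
     list_ex (good_order t) general_orders \<or>
     list_ex (\<lambda>ys. rearrange t ys = rotational) rotational_orders \<or>
     list_all (\<lambda>cs. let s = six_of_list cs in
       sort (scores t s) \<notin> set score_lists \<or> list_ex (good_order_with t s) special_orders) (bit_lists 6))"

text \<open>
  The search over all tournaments on a path of six places. The third alternative, with the scores, is
  reached for two isomorphism types only.
\<close>

lemma settled_path_table:
  assumes "length bs = 10"
  shows "settled bs"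
proof -
  have "list_all (\<lambda>cs. settled (True # cs)) (bit_lists 9)"
    by code_simp
  moreover have "list_all (\<lambda>cs. settled (False # cs)) (bit_lists 9)"
    by code_simp
  moreover obtain b cs where bs: "bs = b # cs" "length cs = 9"
    using assms by (auto simp: numeral_eq_Suc length_Suc_conv)
  moreover have "cs \<in> set (bit_lists 9)"
    by (rule bit_lists_complete) (rule bs(2))
  ultimately show ?thesis by (cases b) (auto simp: list_all_iff)
qed

lemma score_list_sorted: "S \<in> set score_lists \<Longrightarrow> sorted S \<and> 1 \<in> set S"
  by (auto simp: score_lists_def)

lemma path_table_entry:
  assumes tour: "tournament_on (set [x0, x1, x2, x3, x4, x5]) E"
    and dist: "distinct [x0, x1, x2, x3, x4, x5]"
    and path: "successively E [x0, x1, x2, x3, x4, x5]"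
  shows "entry (path_table [E x0 x2, E x0 x3, E x0 x4, E x0 x5, E x1 x3, E x1 x4, E x1 x5, E x2 x4, E x2 x5, E x3 x5]) i j
    = E (pick (Six x0 x1 x2 x3 x4 x5) i) (pick (Six x0 x1 x2 x3 x4 x5) j)"
proof -
  have asym: "E a b \<Longrightarrow> \<not> E b a" and total: "a \<noteq> b \<Longrightarrow> E a b \<or> E b a"
    if "a \<in> set [x0, x1, x2, x3, x4, x5]" "b \<in> set [x0, x1, x2, x3, x4, x5]" for a b
    using tour that unfolding tournament_on_def by blast+
  have flip: "E b a \<longleftrightarrow> \<not> E a b"
    if "a \<in> set [x0, x1, x2, x3, x4, x5]" "b \<in> set [x0, x1, x2, x3, x4, x5]" "a \<noteq> b" for a b
    using asym[OF that(1,2)] total[OF that] by blast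
  have "\<not> E x0 x0" "\<not> E x1 x1" "\<not> E x2 x2" "\<not> E x3 x3" "\<not> E x4 x4" "\<not> E x5 x5"
    using asym[of x0 x0] asym[of x1 x1] asym[of x2 x2] asym[of x3 x3] asym[of x4 x4] asym[of x5 x5] by auto
  moreover have "E x0 x1" "E x1 x2" "E x2 x3" "E x3 x4" "E x4 x5" using path by auto
  moreover from this have "\<not> E x1 x0" "\<not> E x2 x1" "\<not> E x3 x2" "\<not> E x4 x3" "\<not> E x5 x4"
    using asym[of x0 x1] asym[of x1 x2] asym[of x2 x3] asym[of x3 x4] asym[of x4 x5] by auto
  moreover have "E x2 x0 \<longleftrightarrow> \<not> E x0 x2" "E x3 x0 \<longleftrightarrow> \<not> E x0 x3" "E x4 x0 \<longleftrightarrow> \<not> E x0 x4" "E x5 x0 \<longleftrightarrow> \<not> E x0 x5"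
    "E x3 x1 \<longleftrightarrow> \<not> E x1 x3" "E x4 x1 \<longleftrightarrow> \<not> E x1 x4" "E x5 x1 \<longleftrightarrow> \<not> E x1 x5"
    "E x4 x2 \<longleftrightarrow> \<not> E x2 x4" "E x5 x2 \<longleftrightarrow> \<not> E x2 x5" "E x5 x3 \<longleftrightarrow> \<not> E x3 x5"
    by (rule flip; use dist in simp)+
  ultimately show ?thesis
    by (cases i; cases j) (simp_all add: entry_def)
qed

context single_exit
begin

lemma mset_set_V: "mset_set V = {#v, w#} + image_mset x (mset places)"
proof -
  have "mset_set (range x) = image_mset x (mset_set UNIV)"
    by (rule image_mset_mset_set[symmetric]) (rule inj)
  also have "mset_set (UNIV :: place set) = mset places"
    by (simp add: UNIV_place places_def)
  finally show ?thesis unfolding V by (simp add: v_notin w_notin vw)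
qed

lemma out_degree_eq:
  "card {b \<in> V. Q b} = of_bool (Q v) + of_bool (Q w) + (\<Sum>i\<in>UNIV. of_bool (Q (x i)))"
proof -
  have "finite V" unfolding V by simp
  then have "card {b \<in> V. Q b} = (\<Sum>b\<in>V. of_bool (Q b))"
    by (simp add: Int_def)
  also have "\<dots> = of_bool (Q v) + of_bool (Q w) + (\<Sum>b\<in>range x. of_bool (Q b))"
    unfolding V using v_notin w_notin vw by simp
  also have "(\<Sum>b\<in>range x. of_bool (Q b)) = (\<Sum>i\<in>UNIV. of_bool (Q (x i)))"
    by (rule sum.reindex_cong[OF inj]) simp_all
  finally show ?thesis .
qed

lemma total_eq: "total r = (\<Sum>i\<in>UNIV. of_bool (pick r i))"
  by (cases r) (simp add: UNIV_place)

lemma scores_eq: "image_mset (\<lambda>a. card {b \<in> V. E a b}) (mset_set V) = mset (scores t s)"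
proof -
  have v: "card {b \<in> V. E v b} = 1"
    unfolding out_degree_eq using v_w v_x irrefl[of v] by simp
  have w: "card {b \<in> V. E w b} = total s"
    unfolding out_degree_eq total_eq using w_v irrefl[of w] s by simp
  have x: "card {b \<in> V. E (x i) b} = total (pick t i) + 1 + of_bool (\<not> pick s i)" for i
  proof -
    have "E (x i) v" using tour v_x[of i] unfolding tournament_on_def by (metis distinct_nodes(1) in_V(1,3))
    moreover have "E (x i) w \<longleftrightarrow> \<not> pick s i"
      using tour s[of i] unfolding tournament_on_def by (metis distinct_nodes(3) in_V(2,3))
    ultimately show ?thesis unfolding out_degree_eq total_eq using t[of i] by (simp add: entry_def)
  qed
  show ?thesis unfolding mset_set_V scores_def by (simp add: v w x image_mset.compositionality comp_def)
qed

end

text \<open>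
  Label the six vertices other than \<open>v\<close> and \<open>w\<close> along a Hamiltonian path and look the outcome
  of the search up.
\<close>

theorem unlinked_placement:
  assumes tour: "tournament_on V E" and fin: "finite V" "card V = 8"
    and sc: "image_mset (\<lambda>a. card {b \<in> V. E a b}) (mset_set V) = mset S" and S: "S \<in> set score_lists"
  shows "has_unlinked_placement V E"
proof -
  have asym: "E a b \<Longrightarrow> \<not> E b a" and total: "a \<noteq> b \<Longrightarrow> E a b \<or> E b a" if "a \<in> V" "b \<in> V" for a b
    using tour that unfolding tournament_on_def by blast+
  have "1 \<in> set_mset (image_mset (\<lambda>a. card {b \<in> V. E a b}) (mset_set V))"
    unfolding sc using score_list_sorted[OF S] by simp
  then obtain v where v: "v \<in> V" "card {b \<in> V. E v b} = 1" using fin(1) by auto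
  then obtain w where w: "{b \<in> V. E v b} = {w}" by (auto simp: card_1_singleton_iff)
  then have wV: "w \<in> V" "E v w" by auto
  then have "v \<noteq> w" using asym by blast
  define R where "R = V - {v, w}"
  have R: "finite R" "card R = 6" "tournament_on R E"
    using fin v(1) wV(1) \<open>v \<noteq> w\<close> tour by (auto simp: R_def card_Diff_subset tournament_on_def)
  obtain xs where xs: "successively E xs" "distinct xs" "set xs = R"
    using hamiltonian_path[OF R(1,3)] by blast
  have "length xs = 6" using distinct_card[OF xs(2)] xs(3) R(2) by simp
  then obtain x0 x1 x2 x3 x4 x5 where xs_eq: "xs = [x0, x1, x2, x3, x4, x5]"
    by (auto simp: numeral_eq_Suc length_Suc_conv)
  define x where "x = pick (Six x0 x1 x2 x3 x4 x5)"
  have range: "range x = R" unfolding range_place x_def xs(3)[symmetric] xs_eq by auto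
  have inj: "inj x"
  proof (rule injI)
    fix i j assume "x i = x j"
    then show "i = j" using xs(2) unfolding x_def xs_eq by (cases i; cases j) simp_all
  qed
  define bs where "bs = [E x0 x2, E x0 x3, E x0 x4, E x0 x5, E x1 x3, E x1 x4, E x1 x5, E x2 x4, E x2 x5, E x3 x5]"
  define t where "t = path_table bs"
  have t: "entry t i j = E (x i) (x j)" for i j
    unfolding t_def bs_def x_def by (rule path_table_entry) (use R(3) xs xs_eq in simp_all)
  have V: "V = insert v (insert w (range x))" unfolding range R_def using v(1) wV(1) by auto
  have v_x: "\<not> E v (x i)" for i
  proof
    assume "E v (x i)"
    moreover have "x i \<in> R" using range by blast
    ultimately have "x i \<in> {w}" "x i \<noteq> w" unfolding w[symmetric] R_def by auto
    then show False by simp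
  qed
  define cs where "cs = [E w x0, E w x1, E w x2, E w x3, E w x4, E w x5]"
  define s where "s = six_of_list cs"
  have s: "pick s j = E w (x j)" for j by (cases j) (simp_all add: s_def cs_def x_def)
  interpret single_exit V E v w x t s
    by standard (use V \<open>v \<noteq> w\<close> range inj tour wV v_x t s in \<open>auto simp: R_def\<close>)
  have orders: "is_order ys"
    if "ys \<in> set general_orders \<or> ys \<in> set rotational_orders \<or> ys \<in> set special_orders" for ys
    using that are_orders by (auto simp: list_all_iff)
  have "settled bs" by (rule settled_path_table) (simp add: bs_def)
  moreover have "cs \<in> set (bit_lists 6)" by (rule bit_lists_complete) (simp add: cs_def)
  ultimately consider ys where "ys \<in> set general_orders" "good_order t ys"
    | ys where "ys \<in> set rotational_orders" "rearrange t ys = rotational"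
    | "sort (scores t s) \<notin> set score_lists"
    | ys where "ys \<in> set special_orders" "good_order_with t s ys"
    unfolding settled_def Let_def t_def[symmetric] list_ex_iff list_all_iff s_def by blast
  then show ?thesis
  proof cases
    case (1 ys)
    then show ?thesis using unlinked_if_good_order[OF good_order_imp_with[OF 1(2)]] orders by blast
  next
    case (2 ys)
    obtain y0 y1 y2 y3 y4 y5 where ys: "ys = Six y0 y1 y2 y3 y4 y5" by (cases ys)
    have y: "UNIV = {y0, y1, y2, y3, y4, y5}" "distinct [y0, y1, y2, y3, y4, y5]"
      using is_order_UNIV orders[of ys] 2(1) unfolding ys by auto
    have surj: "range (pick ys) = UNIV" unfolding range_place ys using y(1) by simp
    then have "inj (pick ys)" by (simp add: finite_UNIV_surj_inj surj_def)
    then have inj': "inj (x \<circ> pick ys)" using inj by (simp add: inj_compose)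
    have range': "range (x \<circ> pick ys) = range x" using surj by (metis image_comp)
    have pick_map: "pick (map_six f z) i = f (pick z i)" for f :: "'p \<Rightarrow> 'q" and z i
      by (cases z; cases i) simp_all
    have t': "entry rotational i j = E ((x \<circ> pick ys) i) ((x \<circ> pick ys) j)" for i j
      unfolding 2(2)[symmetric] rearrange_def using t by (simp add: entry_def pick_map)
    interpret rot: single_exit V E v w "x \<circ> pick ys" rotational "map_six (E w \<circ> x) ys"
      by standard (use V range' v_notin w_notin vw inj' tour v_w v_x t' in \<open>auto simp: pick_map\<close>)
    show ?thesis by (rule rot.unlinked_if_rotational) simp
  next
    case 3
    have "mset (scores t s) = mset S" using scores_eq sc by simp
    then have "sort (scores t s) = S"
      using score_list_sorted[OF S] by (metis properties_for_sort)
    then show ?thesis using 3 S by simp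
  next
    case (4 ys)
    then show ?thesis using unlinked_if_good_order orders by blast
  qed
qed

section \<open>Tournaments and their reversals\<close>

lemma arcs_ends_reversal: "(a, b) \<in> arcs_ends (reversal T) \<longleftrightarrow> (b, a) \<in> arcs_ends T"
  by (auto simp: arcs_ends_conv reversal_def)

lemma tournament_reversal:
  assumes "tournament T"
  shows "tournament (reversal T)"
proof -
  interpret tournament T by fact
  show ?thesis
  proof
    fix e assume "e \<in> arcs (reversal T)"
    then show "tail (reversal T) e \<in> verts (reversal T)" "head (reversal T) e \<in> verts (reversal T)"
        "tail (reversal T) e \<noteq> head (reversal T) e"
      using no_loops[of e] by (auto simp: reversal_def)
  next
    show "finite (verts (reversal T))" "finite (arcs (reversal T))" by (auto simp: reversal_def)
  next
    fix e f assume "e \<in> arcs (reversal T)" "f \<in> arcs (reversal T)"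
      "arc_to_ends (reversal T) e = arc_to_ends (reversal T) f"
    then show "e = f" using no_multi_arcs[of e f] by (auto simp: reversal_def arc_to_ends_def)
  next
    fix u v assume "u \<in> verts (reversal T)" "v \<in> verts (reversal T)" "u \<noteq> v"
    then show "((u, v) \<in> arcs_ends (reversal T)) \<noteq> ((v, u) \<in> arcs_ends (reversal T))"
      using exactly_one_arc[of v u] unfolding arcs_ends_reversal by (auto simp: reversal_def)
  qed
qed

lemma (in tournament) tournament_on_verts: "tournament_on (verts G) (\<lambda>a b. (a, b) \<in> arcs_ends G)"
  unfolding tournament_on_def using exactly_one_arc adj_not_same by metis

lemma (in tournament) out_degree_card: "out_degree G a = card {b \<in> verts G. (a, b) \<in> arcs_ends G}"
proof -
  have "inj_on (head G) (out_arcs G a)"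
    by (rule inj_onI) (auto simp: out_arcs_def arc_to_ends_def intro: no_multi_arcs)
  moreover have "head G ` out_arcs G a = {b \<in> verts G. (a, b) \<in> arcs_ends G}"
    by (auto simp: arcs_ends_conv)
  ultimately show ?thesis unfolding out_degree_def using card_image by fastforce
qed

lemma unlinked_placement_of_score:
  assumes "tournament T" "card (verts T) = 8" "score_sequence T \<in> set score_lists"
  shows "has_unlinked_placement (verts T) (\<lambda>a b. (a, b) \<in> arcs_ends T)"
proof -
  interpret tournament T by fact
  have "image_mset (\<lambda>a. card {b \<in> verts T. (a, b) \<in> arcs_ends T}) (mset_set (verts T)) = mset (score_sequence T)"
    unfolding score_sequence_def out_degree_card[symmetric] by simp
  then show ?thesis
    using assms tournament_on_verts by (intro unlinked_placement[where S = "score_sequence T"]) simp_all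
qed

lemma dual_dual_score_list: "S \<in> set score_lists \<Longrightarrow> dual_sequence (dual_sequence S) = S"
  by (auto simp: score_lists_def dual_sequence_def)

theorem proposition3p7:
  fixes T :: "('a, 'b) pre_digraph"
  assumes "tournament T"
    and "card (verts T) = 8"
    and "\<exists>S \<in> {[1,2,3,3,4,5,5,5], [1,3,3,3,4,4,4,6], [1,3,4,4,4,4,4,4], [1,2,3,3,4,4,5,6],
                 [1,2,2,4,4,5,5,5], [1,2,4,4,4,4,4,5], [1,3,3,3,3,5,5,5]}.
           score_sequence T = S \<or> score_sequence T = dual_sequence S"
  shows "\<not> intrinsically_linked_digraph T"
proof -
  interpret tournament T by fact
  let ?E = "\<lambda>a b. (a, b) \<in> arcs_ends T"
  obtain S where S: "S \<in> set score_lists" "score_sequence T = S \<or> score_sequence T = dual_sequence S"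
    using assms(3) unfolding score_lists_def by auto
  have "has_unlinked_placement (verts T) ?E"
    using S(2)
  proof
    assume "score_sequence T = S"
    then show ?thesis using unlinked_placement_of_score assms(1,2) S(1) by blast
  next
    assume "score_sequence T = dual_sequence S"
    then have "score_sequence (reversal T) = S"
      by (simp add: score_sequence_reversal dual_dual_score_list[OF S(1)])
    then have "has_unlinked_placement (verts (reversal T)) (\<lambda>a b. (a, b) \<in> arcs_ends (reversal T))"
      using unlinked_placement_of_score[OF tournament_reversal[OF assms(1)]] assms(2) S(1)
      by (simp add: reversal_def)
    then have "has_unlinked_placement (verts T) (\<lambda>a b. (b, a) \<in> arcs_ends T)"
      unfolding arcs_ends_reversal by (simp add: reversal_def)
    then show ?thesis by (rule has_unlinked_placement_converse[THEN iffD1])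
  qed
  then show ?thesis by (rule not_linked_if_unpierced[OF assms(1)])
qed

end
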